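(* There exists a constant $K>0$ such that for every integer $n\ge 2$ and every set $S$ of $n$ points in general position in the plane, there exists a coloring of $S$ with two colors (red and blue) such that the coarseness of the resulting $2$-colored point set satisfies $\mathcal{C}(S)\le K\, n^{1/4}\sqrt{\log n}$.
   Context: General position means that no three points of $S$ are collinear. A coloring of a finite set $S\subset\mathbb{R}^2$ is a map $\mathcal{X}:S\to\{-1,+1\}$ (points mapped to $+1$ are red, points mapped to $-1$ are blue). For $Y\subseteq S$, the discrepancy of $Y$ is $\operatorname{disc}(Y)=\left|\sum_{y\in Y}\mathcal{X}(y)\right|$, i.e. the absolute value of the number of red points minus the number of blue points in $Y$. An island of $S$ is a subset $I\subseteq S$ such that $I=C\cap S$ for some convex set $C\subseteq\mathbb{R}^2$. A convex partition of $S$ is a partition $\Pi=\{S_1,\dots,S_k\}$ of $S$ into (nonempty) islands with pairwise disjoint convex hulls. Its discrepancy is $\operatorname{disc}(\Pi)=\min_{1\le i\le k}\operatorname{disc}(S_i)$. The coarseness of the colored set $S$ is $\mathcal{C}(S)=\max_{\Pi}\operatorname{disc}(\Pi)$, the maximum over all convex partitions $\Pi$ of $S$. *)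

theory Defs
  imports "HOL-Analysis.Analysis"
begin

definition general_position :: "(real^2) set \<Rightarrow> bool" where
  "general_position S \<longleftrightarrow>
     (\<forall>a\<in>S. \<forall>b\<in>S. \<forall>c\<in>S. a \<noteq> b \<and> a \<noteq> c \<and> b \<noteq> c \<longrightarrow> \<not> collinear {a, b, c})"

text \<open>Only the values on \<open>S\<close> matter; all notions below look at \<open>X\<close> on subsets of \<open>S\<close> only.
  Red is \<open>1\<close>, blue is \<open>-1\<close>.\<close>

definition coloring :: "(real^2) set \<Rightarrow> (real^2 \<Rightarrow> int) \<Rightarrow> bool" where
  "coloring S X \<longleftrightarrow> X \<in> S \<rightarrow> {-1, 1}"

definition disc :: "(real^2 \<Rightarrow> int) \<Rightarrow> (real^2) set \<Rightarrow> int" where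
  "disc X Y = \<bar>\<Sum>y\<in>Y. X y\<bar>"

definition island :: "(real^2) set \<Rightarrow> (real^2) set \<Rightarrow> bool" where
  "island S I \<longleftrightarrow> I \<subseteq> S \<and> (\<exists>C. convex C \<and> I = C \<inter> S)"

definition convex_partition :: "(real^2) set \<Rightarrow> (real^2) set set \<Rightarrow> bool" where
  "convex_partition S P \<longleftrightarrow>
     partition_on S P \<and> (\<forall>I\<in>P. island S I) \<and>
     pairwise (\<lambda>A B. disjnt (convex hull A) (convex hull B)) P"

definition disc_partition :: "(real^2 \<Rightarrow> int) \<Rightarrow> (real^2) set set \<Rightarrow> int" where
  "disc_partition X P = Min (disc X ` P)"

definition coarseness :: "(real^2) set \<Rightarrow> (real^2 \<Rightarrow> int) \<Rightarrow> int" where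
  "coarseness S X = Max (disc_partition X ` {P. convex_partition S P})"

text \<open>For finite nonempty \<open>S\<close> the minimum and the maximum above range over finite nonempty sets.\<close>

lemma convex_partition_finite_nonempty:
  assumes "finite S" "S \<noteq> {}" "convex_partition S P"
  shows "finite P" "P \<noteq> {}"
  using assms finite_elements[of S P]
  by (auto simp: convex_partition_def partition_on_def)

lemma finite_convex_partitions:
  assumes "finite S"
  shows "finite {P. convex_partition S P}"
  by (rule finite_subset[of _ "Pow (Pow S)"])
     (use assms in \<open>auto simp: convex_partition_def partition_on_def\<close>)

lemma convex_partitions_nonempty:
  assumes "S \<noteq> {}"
  shows "{P. convex_partition S P} \<noteq> {}"
proof -
  have "convex_partition S {S}"
    using assms
    by (auto simp: convex_partition_def island_def partition_on_def disjoint_def intro: exI[of _ UNIV])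
  then show ?thesis by blast
qed

end

theory Submission
  imports Defs
begin

text \<open>Pair up the points so that every line separates only \<open>O(sqrt n)\<close> of the pairs, and colour the two
  points of each pair oppositely, with signs chosen by the method of conditional expectations. A
  region bounded by a constant number of lines then has discrepancy \<open>O(n^(1/4) sqrt (log n))\<close>.
  It remains to see that every convex partition has a piece that boundedly many lines cut
  out: sweeping a vertical line over \<open>k\<close> disjoint convex hulls meets at most \<open>3 k\<close> pairs of
  vertically consecutive hulls, so some hull has at most six such neighbours; lines separating it
  from these, together with the two vertical lines bounding it, exclude all other points.

  The pairing is built by multiplicative reweighting from a packing bound: among \<open>n\<close> points in the
  plane, two are separated by lines of only an \<open>O(1/sqrt n)\<close> fraction of the total weight. This is
  Haussler's packing argument; it applies with exponent two because the dual system of half-planes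
  has VC dimension two.\<close>

subsection \<open>Set systems of bounded VC dimension\<close>

text \<open>No colouring is good for all islands at once: for points in convex position every subset
  is an island, so a colour class is an island of large discrepancy. What helps is that the
  discrepancy of a partition is a minimum: one piece with a short description suffices, and only
  polynomially many such pieces exist. The two factors of the bound have separate sources. An
  oppositely coloured pair contributes to a range only if the range splits it, so up to the unpaired
  point the discrepancy is a sum of O(sqrt n) signs, of typical size n^(1/4); asking this of
  polynomially many ranges simultaneously costs sqrt (log n). The packing bound comes from sampling
  m ranges. They sort the points into O(m^2) classes, so with m about sqrt (n/2) many points share a
  class, and if all pairs were far apart, redrawing one range would split these classes heavily. But
  the total splitting over the m sampled ranges is at most 2 n by the one-inclusion bound; hence
  some pair has distance of order 1/m.\<close>

text \<open>The set system is the support of \<open>N\<close>. The values of \<open>N\<close> are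
  multiplicities, which later count the points realising a given pattern of ranges.\<close>

definition vc_le :: "nat \<Rightarrow> 'i set \<Rightarrow> ('i set \<Rightarrow> nat) \<Rightarrow> bool" where
  "vc_le d I N \<longleftrightarrow> (\<forall>A\<subseteq>I. (\<forall>B\<subseteq>A. \<exists>C\<subseteq>I. 0 < N C \<and> C \<inter> A = B) \<longrightarrow> card A \<le> d)"

lemma sum_Pow_insert:
  assumes "finite J" "x \<notin> J"
  shows "(\<Sum>C\<in>Pow (insert x J). f C) = (\<Sum>C\<in>Pow J. f C + f (insert x C))"
proof -
  have inj: "inj_on (insert x) (Pow J)"
    using assms(2) by (auto simp: inj_on_def)
  have "(\<Sum>C\<in>Pow (insert x J). f C) = (\<Sum>C\<in>Pow J. f C) + (\<Sum>C\<in>insert x ` Pow J. f C)"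
    unfolding Pow_insert using assms by (intro sum.union_disjoint) auto
  also have "(\<Sum>C\<in>insert x ` Pow J. f C) = (\<Sum>C\<in>Pow J. f (insert x C))"
    using inj by (simp add: sum.reindex)
  finally show ?thesis
    by (simp add: sum.distrib)
qed

text \<open>The support of the maximum is the projection of the system to \<open>J\<close>, and
  projecting creates no new shattered sets.\<close>

lemma vc_le_max:
  assumes "vc_le d (insert x J) N" "x \<notin> J"
  shows "vc_le d J (\<lambda>C. max (N C) (N (insert x C)))"
  unfolding vc_le_def
proof (intro allI impI)
  fix A assume A: "A \<subseteq> J" and sh: "\<forall>B\<subseteq>A. \<exists>C\<subseteq>J. 0 < max (N C) (N (insert x C)) \<and> C \<inter> A = B"
  have "\<exists>C\<subseteq>insert x J. 0 < N C \<and> C \<inter> A = B" if B: "B \<subseteq> A" for B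
  proof -
    from sh B obtain C where C: "C \<subseteq> J" "0 < N C \<or> 0 < N (insert x C)" "C \<inter> A = B"
      by (auto simp: less_max_iff_disj)
    have "insert x C \<inter> A = B"
      using C(3) A assms(2) by auto
    with C show ?thesis
      by (metis insert_mono subset_insertI2)
  qed
  with assms(1) A show "card A \<le> d"
    unfolding vc_le_def by (metis subset_insertI2)
qed

text \<open>The support of the minimum consists of the sets present both with and without
  \<open>x\<close>; if it shatters \<open>A\<close>, the original system shatters
  \<open>insert x A\<close>. The form with \<open>Suc (card A)\<close> also serves
  \<open>d = 0\<close>, where it is a contradiction.\<close>

lemma vc_le_min:
  assumes "vc_le d (insert x J) N" "x \<notin> J" "finite J" 
  assumes A: "A \<subseteq> J" and sh: "\<And>B. B \<subseteq> A \<Longrightarrow> \<exists>C\<subseteq>J. 0 < min (N C) (N (insert x C)) \<and> C \<inter> A = B"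
  shows "Suc (card A) \<le> d"
proof -
  have "\<exists>C\<subseteq>insert x J. 0 < N C \<and> C \<inter> insert x A = B" if B: "B \<subseteq> insert x A" for B
  proof -
    from sh[of "B - {x}"] B obtain C where C: "C \<subseteq> J" "0 < N C" "0 < N (insert x C)" "C \<inter> A = B - {x}"
      by auto
    show ?thesis
    proof (cases "x \<in> B")
      case True
      then have "insert x C \<inter> insert x A = B" using C B by auto
      with C show ?thesis by (metis insert_mono)
    next
      case False
      then have "C \<inter> insert x A = B" using C B assms(2) by auto
      with C show ?thesis by (metis subset_insertI2)
    qed
  qed
  then have "card (insert x A) \<le> d"
    using assms(1) A unfolding vc_le_def by (metis insert_mono)
  moreover have "card (insert x A) = Suc (card A)"
    using A assms(2,3) by (meson card_insert_disjoint finite_subset subsetD)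
  ultimately show ?thesis by simp
qed

lemma vc_le_min_pred:
  assumes "vc_le (Suc d) (insert x J) N" "x \<notin> J" "finite J"
  shows "vc_le d J (\<lambda>C. min (N C) (N (insert x C)))"
  unfolding vc_le_def using vc_le_min[OF assms] by auto

lemma vc_le_0_min:
  assumes "vc_le 0 (insert x J) N" "x \<notin> J" "finite J" "C \<subseteq> J"
  shows "min (N C) (N (insert x C)) = 0"
proof (rule ccontr)
  assume "min (N C) (N (insert x C)) \<noteq> 0"
  then have "Suc (card ({}::'a set)) \<le> 0"
    by (intro vc_le_min[OF assms(1-3)]) (use assms(4) in auto)
  then show False by simp
qed

text \<open>Since a + b = max a b + min a b, the sum splits into the projection, of dimension
  \<open>d\<close>, and the doubled sets, of dimension one less. The crude power closes the
  induction by m^d + m^(d-1) \<le> (m+1)^d with m = \<open>card J + 1\<close>.\<close>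

lemma sauer:
  assumes "finite I" "vc_le d I N" "\<And>C. N C \<le> 1"
  shows "(\<Sum>C\<in>Pow I. N C) \<le> (card I + 1) ^ d"
  using assms
proof (induction I arbitrary: d N rule: finite_induct)
  case empty
  then show ?case by simp
next
  case (insert x J)
  let ?M = "\<lambda>C. max (N C) (N (insert x C))" and ?m = "\<lambda>C. min (N C) (N (insert x C))"
  have eq: "(\<Sum>C\<in>Pow (insert x J). N C) = (\<Sum>C\<in>Pow J. ?M C) + (\<Sum>C\<in>Pow J. ?m C)"
    using insert.hyps by (subst sum_Pow_insert) (auto simp: sum.distrib[symmetric] intro!: sum.cong)
  have M: "(\<Sum>C\<in>Pow J. ?M C) \<le> (card J + 1) ^ d"
    using insert.prems insert.hyps by (intro insert.IH vc_le_max) auto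
  show ?case
  proof (cases d)
    case 0
    then have "(\<Sum>C\<in>Pow J. ?m C) = 0"
      using vc_le_0_min[of x J N] insert by (intro sum.neutral) auto
    then show ?thesis using M eq 0 by simp
  next
    case (Suc e)
    have "vc_le e J ?m"
      using vc_le_min_pred[of e x J N] insert Suc by simp
    then have "(\<Sum>C\<in>Pow J. ?m C) \<le> (card J + 1) ^ e"
      using insert.prems(2) by (intro insert.IH) (auto intro: min.coboundedI1)
    then have "(\<Sum>C\<in>Pow (insert x J). N C) \<le> (card J + 2) * (card J + 1) ^ e"
      using M eq Suc by simp
    also have "\<dots> \<le> (card J + 2) * (card J + 2) ^ e"
      by (intro mult_left_mono power_mono) auto
    finally show ?thesis using insert.hyps Suc by simp
  qed
qed

text \<open>Haussler, Littlestone and Warmuth: the one-inclusion graph of a set system of VC dimension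
  \<open>d\<close> has at most \<open>d\<close> edges per vertex; here in weighted form.\<close>

lemma one_inclusion_weight:
  assumes "finite I" "vc_le d I N"
  shows "(\<Sum>i\<in>I. \<Sum>C\<in>Pow (I - {i}). min (N C) (N (insert i C))) \<le> d * (\<Sum>C\<in>Pow I. N C)"
  using assms
proof (induction I arbitrary: d N rule: finite_induct)
  case empty
  then show ?case by simp
next
  case (insert x J)
  let ?M = "\<lambda>C. max (N C) (N (insert x C))" and ?m = "\<lambda>C. min (N C) (N (insert x C))"
  let ?E = "\<lambda>I N. \<Sum>i\<in>I. \<Sum>C\<in>Pow (I - {i}). min (N C) (N (insert i C) :: nat)"
  have eq: "(\<Sum>C\<in>Pow (insert x J). N C) = (\<Sum>C\<in>Pow J. ?M C) + (\<Sum>C\<in>Pow J. ?m C)"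
    using insert.hyps by (subst sum_Pow_insert) (auto simp: sum.distrib[symmetric] intro!: sum.cong)
  \<comment> \<open>With a = \<open>N C\<close>, b = \<open>N (insert i C)\<close>, and c, d the
    same after inserting \<open>x\<close>: min(a,b) + min(c,d) is at most min(max(a,c), max(b,d)) +
    min(a,b,c,d), because one of the two minima is the least of all four values and the other is
    below both maxima. The edges in direction \<open>x\<close> give the extra sum of
    \<open>?m\<close> that turns \<open>e\<close> into \<open>Suc e\<close>.\<close>
  have step: "(\<Sum>C\<in>Pow (insert x J - {i}). min (N C) (N (insert i C)))
      \<le> (\<Sum>C\<in>Pow (J - {i}). min (?M C) (?M (insert i C)) + min (?m C) (?m (insert i C)))"
    if "i \<in> J" for i
  proof -
    have *: "insert x J - {i} = insert x (J - {i})"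
      using that insert.hyps by auto
    show ?thesis
      unfolding * using insert.hyps
      by (subst sum_Pow_insert)
         (auto intro!: sum_mono simp: insert_commute[of i x] split: split_min split_max)
  qed
  have "?E (insert x J) N = (\<Sum>C\<in>Pow J. ?m C)
      + (\<Sum>i\<in>J. \<Sum>C\<in>Pow (insert x J - {i}). min (N C) (N (insert i C)))"
    using insert.hyps by simp
  also have "\<dots> \<le> (\<Sum>C\<in>Pow J. ?m C) + (?E J ?M + ?E J ?m)"
    by (intro add_left_mono order.trans[OF sum_mono[OF step]]) (simp_all add: sum.distrib)
  finally have E: "?E (insert x J) N \<le> (\<Sum>C\<in>Pow J. ?m C) + (?E J ?M + ?E J ?m)" .
  have M: "?E J ?M \<le> d * (\<Sum>C\<in>Pow J. ?M C)"
    using insert by (intro insert.IH vc_le_max) auto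
  show ?case
  proof (cases d)
    case 0
    have z: "?m C = 0" if "C \<subseteq> J" for C
      using vc_le_0_min[of x J N C] insert that 0 by simp
    have "(\<Sum>C\<in>Pow J. ?m C) = 0"
      using z by (auto intro!: sum.neutral)
    moreover have "?E J ?m = 0"
      by (intro sum.neutral ballI) (subst z, auto)
    ultimately have "(\<Sum>C\<in>Pow J. ?m C) = 0" "?E J ?m = 0" .
    then show ?thesis using M E 0 by simp
  next
    case (Suc e)
    have "?E J ?m \<le> e * (\<Sum>C\<in>Pow J. ?m C)"
      using vc_le_min_pred[of e x J N] insert Suc by (intro insert.IH) auto
    then show ?thesis using M E eq Suc by (simp add: algebra_simps)
  qed
qed

subsection \<open>Packing points with respect to weighted ranges\<close>

text \<open>An expectation written as a finite sum: \<rho> is a sample of independent elements of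
  \<open>L\<close>, drawn with probability proportional to \<open>w\<close>. Redrawing coordinate
  \<open>i\<close> alone gives \<open>g i\<close> a mean of at least \<alpha> /
  \<open>sum w L\<close>, while the sum of the \<open>g i\<close> never exceeds \<beta>.\<close>

lemma weighted_average_le:
  fixes g :: "'i \<Rightarrow> ('i \<Rightarrow> 'x) \<Rightarrow> real" and w :: "'x \<Rightarrow> real" and \<alpha> \<beta> :: real
  assumes I: "finite I" and L: "finite L"
    and w: "\<And>x. x \<in> L \<Longrightarrow> 0 \<le> w x" and W: "0 < sum w L"
    and lower: "\<And>i \<rho>. i \<in> I \<Longrightarrow> \<rho> \<in> Pi\<^sub>E (I - {i}) (\<lambda>_. L) \<Longrightarrow> \<alpha> \<le> (\<Sum>x\<in>L. w x * g i (\<rho>(i := x)))"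
    and upper: "\<And>\<rho>. \<rho> \<in> Pi\<^sub>E I (\<lambda>_. L) \<Longrightarrow> (\<Sum>i\<in>I. g i \<rho>) \<le> \<beta>"
    and "I \<noteq> {}"
  shows "card I * \<alpha> \<le> \<beta> * sum w L"
proof -
  define W where "W = sum w L"
  have tot: "(\<Sum>\<rho>\<in>Pi\<^sub>E J (\<lambda>_. L). \<Prod>j\<in>J. w (\<rho> j)) = W ^ card J" if "finite J" for J :: "'i set"
    using prod_sum_PiE[of J "\<lambda>_. L" "\<lambda>_. w"] that L by (simp add: W_def)
  have card: "card (I - {i}) = card I - 1" if "i \<in> I" for i
    using that I by simp
  have each: "\<alpha> * W ^ (card I - 1) \<le> (\<Sum>\<rho>\<in>Pi\<^sub>E I (\<lambda>_. L). (\<Prod>j\<in>I. w (\<rho> j)) * g i \<rho>)" if i: "i \<in> I" for i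
  proof -
    let ?J = "I - {i}"
    have PiE_eq: "Pi\<^sub>E I (\<lambda>_. L) = (\<lambda>(x, \<rho>). \<rho>(i := x)) ` (L \<times> Pi\<^sub>E ?J (\<lambda>_. L))"
      using PiE_insert_eq[of i ?J "\<lambda>_. L"] i by (simp add: insert_absorb)
    have "(\<Sum>\<rho>\<in>Pi\<^sub>E I (\<lambda>_. L). (\<Prod>j\<in>I. w (\<rho> j)) * g i \<rho>)
        = (\<Sum>(x,\<rho>)\<in>L \<times> Pi\<^sub>E ?J (\<lambda>_. L). (\<Prod>j\<in>I. w ((\<rho>(i := x)) j)) * g i (\<rho>(i := x)))"
      unfolding PiE_eq by (subst sum.reindex[OF inj_combinator]) (auto simp: case_prod_unfold)
    also have "\<dots> = (\<Sum>\<rho>\<in>Pi\<^sub>E ?J (\<lambda>_. L). \<Sum>x\<in>L. (\<Prod>j\<in>I. w ((\<rho>(i := x)) j)) * g i (\<rho>(i := x)))"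
      by (subst sum.cartesian_product[symmetric]) (rule sum.swap)
    also have "\<dots> = (\<Sum>\<rho>\<in>Pi\<^sub>E ?J (\<lambda>_. L). (\<Prod>j\<in>?J. w (\<rho> j)) * (\<Sum>x\<in>L. w x * g i (\<rho>(i := x))))"
    proof (intro sum.cong refl)
      fix \<rho>
      have "(\<Prod>j\<in>I. w ((\<rho>(i := x)) j)) = w x * (\<Prod>j\<in>?J. w (\<rho> j))" for x
        using I i by (simp add: prod.remove[of I i])
      then show "(\<Sum>x\<in>L. (\<Prod>j\<in>I. w ((\<rho>(i := x)) j)) * g i (\<rho>(i := x)))
          = (\<Prod>j\<in>?J. w (\<rho> j)) * (\<Sum>x\<in>L. w x * g i (\<rho>(i := x)))"
        by (simp add: sum_distrib_left mult_ac)
    qed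
    also have "\<dots> \<ge> (\<Sum>\<rho>\<in>Pi\<^sub>E ?J (\<lambda>_. L). (\<Prod>j\<in>?J. w (\<rho> j)) * \<alpha>)"
      using i w by (intro sum_mono mult_left_mono lower prod_nonneg) (auto simp: PiE_iff)
    also have "(\<Sum>\<rho>\<in>Pi\<^sub>E ?J (\<lambda>_. L). (\<Prod>j\<in>?J. w (\<rho> j)) * \<alpha>) = \<alpha> * W ^ (card I - 1)"
      using I tot[of ?J] card[OF i] by (simp add: sum_distrib_right[symmetric])
    finally show ?thesis .
  qed
  have "card I * (\<alpha> * W ^ (card I - 1)) \<le> (\<Sum>i\<in>I. \<Sum>\<rho>\<in>Pi\<^sub>E I (\<lambda>_. L). (\<Prod>j\<in>I. w (\<rho> j)) * g i \<rho>)"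
    using sum_bounded_below[of I "\<alpha> * W ^ (card I - 1)"] each by simp
  also have "\<dots> = (\<Sum>\<rho>\<in>Pi\<^sub>E I (\<lambda>_. L). (\<Prod>j\<in>I. w (\<rho> j)) * (\<Sum>i\<in>I. g i \<rho>))"
    by (subst sum.swap) (simp add: sum_distrib_left)
  also have "\<dots> \<le> (\<Sum>\<rho>\<in>Pi\<^sub>E I (\<lambda>_. L). (\<Prod>j\<in>I. w (\<rho> j)) * \<beta>)"
    using w by (intro sum_mono mult_left_mono upper prod_nonneg) (auto simp: PiE_iff)
  also have "\<dots> = \<beta> * W ^ card I"
    using tot[OF I] by (simp add: sum_distrib_right[symmetric])
  also have "\<dots> = \<beta> * W * W ^ (card I - 1)"
    using I \<open>I \<noteq> {}\<close> by (cases "card I") auto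
  finally have "(card I * \<alpha>) * W ^ (card I - 1) \<le> (\<beta> * W) * W ^ (card I - 1)"
    by (simp add: mult_ac)
  then show ?thesis
    using W by (simp add: W_def)
qed

lemma sum_pairs_split:
  assumes "finite Q"
  shows "(\<Sum>p\<in>Q. \<Sum>q\<in>Q. of_bool (P p \<noteq> P q) :: real)
    = 2 * real (card {p\<in>Q. P p}) * real (card {p\<in>Q. \<not> P p})"
proof -
  have *: "(\<Sum>q\<in>Q. of_bool (P p \<noteq> P q) :: real)
      = (if P p then real (card {p\<in>Q. \<not> P p}) else real (card {p\<in>Q. P p}))" for p
    using assms by (auto simp: Int_def)
  show ?thesis
    unfolding * using assms by (simp add: sum.If_cases Int_def)
qed

text \<open>Over ordered pairs of \<open>Q\<close> the distances sum to at least n (n - 1) D. A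
  range splitting \<open>Q\<close> into a and b points is counted 2 a b times, and a b \<le> n
  min(a, b). The \<open>of_bool\<close> term covers empty cells, so that summing over all patterns
  loses only the number of nonempty ones.\<close>

lemma cell_split_lower:
  fixes w :: "'x \<Rightarrow> real"
  assumes Q: "finite Q" and L: "finite L" and w: "\<And>x. x \<in> L \<Longrightarrow> 0 \<le> w x"
    and far: "\<And>p q. p \<in> Q \<Longrightarrow> q \<in> Q \<Longrightarrow> p \<noteq> q \<Longrightarrow> D \<le> (\<Sum>x\<in>L. w x * of_bool (mem p x \<noteq> mem q x))"
  shows "(real (card Q) - of_bool (Q \<noteq> {})) / 2 * D
    \<le> (\<Sum>x\<in>L. w x * real (min (card {p\<in>Q. \<not> mem p x}) (card {p\<in>Q. mem p x})))"
proof (cases "Q = {}")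
  case True
  then show ?thesis by simp
next
  case False
  define n where "n = real (card Q)"
  have n: "n > 0" using False Q by (simp add: n_def card_gt_0_iff)
  have "n * (n - 1) * D = (\<Sum>p\<in>Q. \<Sum>q\<in>Q - {p}. D)"
    using Q False by (simp add: n_def card_Diff_singleton of_nat_diff card_gt_0_iff Suc_leI)
  also have "\<dots> \<le> (\<Sum>p\<in>Q. \<Sum>q\<in>Q - {p}. \<Sum>x\<in>L. w x * of_bool (mem p x \<noteq> mem q x))"
    by (intro sum_mono far) auto
  also have "\<dots> \<le> (\<Sum>p\<in>Q. \<Sum>q\<in>Q. \<Sum>x\<in>L. w x * of_bool (mem p x \<noteq> mem q x))"
    using Q w by (intro sum_mono sum_mono2) (auto intro!: sum_nonneg)
  also have "\<dots> = (\<Sum>p\<in>Q. \<Sum>x\<in>L. \<Sum>q\<in>Q. w x * of_bool (mem p x \<noteq> mem q x))"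
    by (intro sum.cong refl sum.swap)
  also have "\<dots> = (\<Sum>x\<in>L. \<Sum>p\<in>Q. \<Sum>q\<in>Q. w x * of_bool (mem p x \<noteq> mem q x))"
    by (rule sum.swap)
  also have "\<dots> = (\<Sum>x\<in>L. w x * (2 * real (card {p\<in>Q. mem p x}) * real (card {p\<in>Q. \<not> mem p x})))"
    by (intro sum.cong refl)
       (simp only: sum_distrib_left[symmetric] sum_pairs_split[OF Q])
  also have "\<dots> \<le> (\<Sum>x\<in>L. w x * (2 * (n * real (min (card {p\<in>Q. \<not> mem p x}) (card {p\<in>Q. mem p x})))))"
  proof (intro sum_mono mult_left_mono w)
    fix x
    let ?a = "card {p\<in>Q. mem p x}" and ?b = "card {p\<in>Q. \<not> mem p x}"
    have le: "?a \<le> card Q" "?b \<le> card Q" using Q by (auto intro!: card_mono)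
    have "?a * ?b = max ?a ?b * min ?b ?a"
      by (simp add: min_def max_def)
    also have "\<dots> \<le> card Q * min ?b ?a"
      using le by (intro mult_right_mono) auto
    finally have "real (?a * ?b) \<le> real (card Q * min ?b ?a)"
      by (rule of_nat_mono)
    then show "2 * real ?a * real ?b \<le> 2 * (n * real (min ?b ?a))"
      unfolding n_def of_nat_mult by linarith
  qed
  also have "\<dots> = n * (2 * (\<Sum>x\<in>L. w x * real (min (card {p\<in>Q. \<not> mem p x}) (card {p\<in>Q. mem p x}))))"
    by (simp add: sum_distrib_left mult_ac)
  finally have "n * ((n - 1) * D) \<le> n * (2 * (\<Sum>x\<in>L. w x * real (min (card {p\<in>Q. \<not> mem p x}) (card {p\<in>Q. mem p x}))))"
    by (simp add: mult_ac)
  then have "(n - 1) * D \<le> 2 * (\<Sum>x\<in>L. w x * real (min (card {p\<in>Q. \<not> mem p x}) (card {p\<in>Q. mem p x})))"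
    using n by simp
  then show ?thesis
    using False by (simp add: n_def)
qed

text \<open>The projection of \<open>P\<close> to a sample \<rho> of ranges, as a weighted set
  system on the indices of the sample.\<close>

definition pattern_count :: "('p \<Rightarrow> 'x \<Rightarrow> bool) \<Rightarrow> 'p set \<Rightarrow> 'i set \<Rightarrow> ('i \<Rightarrow> 'x) \<Rightarrow> 'i set \<Rightarrow> nat" where
  "pattern_count mem P I \<rho> C = card {p \<in> P. {i \<in> I. mem p (\<rho> i)} = C}"

lemma sum_pattern_count:
  assumes "finite P" "finite I"
  shows "(\<Sum>C\<in>Pow I. pattern_count mem P I \<rho> C) = card P"
proof -
  have "(\<Sum>C\<in>Pow I. \<Sum>p | p \<in> P \<and> {i \<in> I. mem p (\<rho> i)} = C. 1) = (\<Sum>p\<in>P. 1::nat)"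
    using assms by (intro sum.group) auto
  then show ?thesis by (simp add: pattern_count_def)
qed

text \<open>Redrawing coordinate \<open>i\<close> divides each cell of the other coordinates in two;
  the parts are the ends of a one-inclusion edge in direction \<open>i\<close>.\<close>

lemma pattern_count_upd:
  assumes "i \<in> I" "C \<subseteq> I - {i}"
  shows "pattern_count mem P I (\<rho>(i := x)) C
      = card {p \<in> {p \<in> P. {j \<in> I - {i}. mem p (\<rho> j)} = C}. \<not> mem p x}"
    and "pattern_count mem P I (\<rho>(i := x)) (insert i C)
      = card {p \<in> {p \<in> P. {j \<in> I - {i}. mem p (\<rho> j)} = C}. mem p x}"
proof -
  have i: "i \<notin> C" using assms(2) by auto
  have *: "{j \<in> I. mem p ((\<rho>(i := x)) j)}
      = (if mem p x then insert i {j \<in> I - {i}. mem p (\<rho> j)} else {j \<in> I - {i}. mem p (\<rho> j)})"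
    (is "?A p = (if _ then insert i (?B p) else _)") for p
    using assms(1) by (auto split: if_splits)
  have A1: "?A p = C \<longleftrightarrow> ?B p = C \<and> \<not> mem p x" for p
  proof (cases "mem p x")
    case True
    then show ?thesis using *[of p] i by (metis insertI1)
  next
    case False
    then show ?thesis using *[of p] by simp
  qed
  then show "pattern_count mem P I (\<rho>(i := x)) C
      = card {p \<in> {p \<in> P. {j \<in> I - {i}. mem p (\<rho> j)} = C}. \<not> mem p x}"
    unfolding pattern_count_def A1 by (simp only: mem_Collect_eq conj_assoc)
  have A2: "?A p = insert i C \<longleftrightarrow> ?B p = C \<and> mem p x" for p
  proof (cases "mem p x")
    case True
    have "insert i (?B p) = insert i C \<longleftrightarrow> ?B p = C"
      using i by (intro insert_ident) auto
    then show ?thesis using *[of p] True by (simp only: if_True simp_thms)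
  next
    case False
    have "i \<notin> ?B p" by simp
    then show ?thesis using *[of p] False by (metis insertI1)
  qed
  then show "pattern_count mem P I (\<rho>(i := x)) (insert i C)
      = card {p \<in> {p \<in> P. {j \<in> I - {i}. mem p (\<rho> j)} = C}. mem p x}"
    unfolding pattern_count_def A2 by (simp only: mem_Collect_eq conj_assoc)
qed

text \<open>Triples may repeat a range. The condition thus passes to samples in which distinct
  indices carry the same range.\<close>

definition dual_vc2 :: "('p \<Rightarrow> 'x \<Rightarrow> bool) \<Rightarrow> 'p set \<Rightarrow> 'x set \<Rightarrow> bool" where
  "dual_vc2 mem P L \<longleftrightarrow> (\<forall>x1\<in>L. \<forall>x2\<in>L. \<forall>x3\<in>L. \<exists>b1 b2 b3. \<forall>p\<in>P.
     \<not> (mem p x1 = b1 \<and> mem p x2 = b2 \<and> mem p x3 = b3))"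

lemma dual_vc2_vc_le:
  assumes "dual_vc2 mem P L" "\<And>i. i \<in> I \<Longrightarrow> \<rho> i \<in> L"
  shows "vc_le 2 I (pattern_count mem P I \<rho>)"
  unfolding vc_le_def
proof (intro allI impI)
  fix A assume A: "A \<subseteq> I" and sh: "\<forall>B\<subseteq>A. \<exists>C\<subseteq>I. 0 < pattern_count mem P I \<rho> C \<and> C \<inter> A = B"
  show "card A \<le> 2"
  proof (rule ccontr)
    assume "\<not> card A \<le> 2"
    then have "3 \<le> card A" by simp
    then obtain T where T: "T \<subseteq> A" "card T = 3"
      by (meson obtain_subset_with_card_n)
    then obtain i j k where ijk: "T = {i,j,k}" "i \<noteq> j" "j \<noteq> k" "i \<noteq> k"
      by (auto simp: card_3_iff)
    have L: "\<rho> i \<in> L" "\<rho> j \<in> L" "\<rho> k \<in> L"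
      using T ijk A assms(2) by auto
    obtain b1 b2 b3 where b: "\<And>p. p \<in> P \<Longrightarrow> \<not> (mem p (\<rho> i) = b1 \<and> mem p (\<rho> j) = b2 \<and> mem p (\<rho> k) = b3)"
      using assms(1)[unfolded dual_vc2_def, THEN bspec, OF L(1), THEN bspec, OF L(2), THEN bspec, OF L(3)]
      by blast
    define B where "B = {l \<in> {i,j,k}. (l = i \<and> b1) \<or> (l = j \<and> b2) \<or> (l = k \<and> b3)}"
    have "B \<subseteq> A" using T ijk by (auto simp: B_def)
    then obtain C where C: "C \<subseteq> I" "0 < pattern_count mem P I \<rho> C" "C \<inter> A = B"
      using sh by blast
    then have "{p \<in> P. {l \<in> I. mem p (\<rho> l)} = C} \<noteq> {}"
      unfolding pattern_count_def by (intro notI) (simp only: card.empty)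
    then obtain p where p: "p \<in> P" "{l \<in> I. mem p (\<rho> l)} = C"
      by blast
    have B: "mem p (\<rho> l) \<longleftrightarrow> l \<in> B" if "l \<in> {i,j,k}" for l
    proof -
      have "l \<in> A" "l \<in> I" using that T ijk A by blast+
      then show ?thesis using p(2) C(3) by blast
    qed
    have "mem p (\<rho> i) = b1" "mem p (\<rho> j) = b2" "mem p (\<rho> k) = b3"
      unfolding B[of i, simplified] B[of j, simplified] B[of k, simplified] B_def using ijk by simp_all
    then show False using b p(1) by blast
  qed
qed

lemma dual_vc2_subset:
  assumes "dual_vc2 mem P L" "Q \<subseteq> P"
  shows "dual_vc2 mem Q L"
  unfolding dual_vc2_def
proof (intro ballI)
  fix x1 x2 x3 assume L: "x1 \<in> L" "x2 \<in> L" "x3 \<in> L"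
  obtain b1 b2 b3 where "\<forall>p\<in>P. \<not> (mem p x1 = b1 \<and> mem p x2 = b2 \<and> mem p x3 = b3)"
    using assms(1)[unfolded dual_vc2_def, THEN bspec, OF L(1), THEN bspec, OF L(2), THEN bspec, OF L(3)]
    by blast
  then have "\<forall>p\<in>Q. \<not> (mem p x1 = b1 \<and> mem p x2 = b2 \<and> mem p x3 = b3)"
    using assms(2) by (simp add: subset_iff)
  then show "\<exists>b1 b2 b3. \<forall>p\<in>Q. \<not> (mem p x1 = b1 \<and> mem p x2 = b2 \<and> mem p x3 = b3)"
    by (intro exI)
qed

lemma card_cells_le:
  assumes "dual_vc2 mem P L" "finite P" "finite I" "\<And>i. i \<in> I \<Longrightarrow> \<rho> i \<in> L"
  shows "(\<Sum>C\<in>Pow I. of_bool ({p \<in> P. {i \<in> I. mem p (\<rho> i)} = C} \<noteq> {}) :: nat) \<le> (card I + 1) ^ 2"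
proof (rule sauer[OF assms(3)])
  have "vc_le 2 I (pattern_count mem P I \<rho>)"
    using assms by (intro dual_vc2_vc_le) auto
  moreover have "0 < (of_bool ({p \<in> P. {i \<in> I. mem p (\<rho> i)} = C} \<noteq> {}) :: nat)
      \<longleftrightarrow> 0 < pattern_count mem P I \<rho> C" for C
    unfolding pattern_count_def card_gt_0_iff using assms(2) by simp
  ultimately show "vc_le 2 I (\<lambda>C. of_bool ({p \<in> P. {i \<in> I. mem p (\<rho> i)} = C} \<noteq> {}))"
    unfolding vc_le_def by (simp only:)
qed simp


lemma packing_sample:
  fixes w :: "'x \<Rightarrow> real"
  assumes P: "finite P" and L: "finite L" and w: "\<And>x. x \<in> L \<Longrightarrow> 0 \<le> w x" and W: "0 < sum w L"
    and vc: "dual_vc2 mem P L"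
    and far: "\<And>p q. p \<in> P \<Longrightarrow> q \<in> P \<Longrightarrow> p \<noteq> q \<Longrightarrow> D \<le> (\<Sum>x\<in>L. w x * of_bool (mem p x \<noteq> mem q x))"
    and m: "0 < m" and D: "0 \<le> D"
  shows "m * ((real (card P) - real m ^ 2) / 2 * D) \<le> 2 * real (card P) * sum w L"
proof -
  \<comment> \<open>The weight of the one-inclusion edges in direction \<open>i\<close>: summed over
    the cells of the other m - 1 ranges, the size of the smaller part left by range
    \<open>i\<close>.\<close>
  define g where "g = (\<lambda>i \<rho>. real (\<Sum>C\<in>Pow ({..<m} - {i}).
     min (pattern_count mem P {..<m} \<rho> C) (pattern_count mem P {..<m} \<rho> (insert i C))))"
  have "card {..<m} * ((real (card P) - real m ^ 2) / 2 * D) \<le> (2 * real (card P)) * sum w L"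
  proof (rule weighted_average_le[where g = g, OF _ L w W])
    fix \<rho> assume \<rho>: "\<rho> \<in> Pi\<^sub>E {..<m} (\<lambda>_. L)"
    have "(\<Sum>i<m. \<Sum>C\<in>Pow ({..<m} - {i}).
       min (pattern_count mem P {..<m} \<rho> C) (pattern_count mem P {..<m} \<rho> (insert i C)))
       \<le> 2 * (\<Sum>C\<in>Pow {..<m}. pattern_count mem P {..<m} \<rho> C)"
      using \<rho> by (intro one_inclusion_weight dual_vc2_vc_le[OF vc]) auto
    also have "\<dots> = 2 * card P"
      using P by (simp add: sum_pattern_count)
    finally show "(\<Sum>i<m. g i \<rho>) \<le> 2 * real (card P)"
      unfolding g_def by (simp flip: of_nat_sum)
  next
    fix i \<rho> assume i: "i \<in> {..<m}" and \<rho>: "\<rho> \<in> Pi\<^sub>E ({..<m} - {i}) (\<lambda>_. L)"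
    let ?J = "{..<m} - {i}"
    let ?Q = "\<lambda>C. {p \<in> P. {j \<in> ?J. mem p (\<rho> j)} = C}"
    \<comment> \<open>The other m - 1 ranges form at most m^2 nonempty cells, and each of them costs
      one point in \<open>cell_split_lower\<close>.\<close>
    have "(\<Sum>C\<in>Pow ?J. of_bool (?Q C \<noteq> {}) :: nat) \<le> (card ?J + 1) ^ 2"
      using \<rho> by (intro card_cells_le[OF vc P]) auto
    also have "card ?J + 1 = m"
      using i by simp
    finally have "real (\<Sum>C\<in>Pow ?J. of_bool (?Q C \<noteq> {})) \<le> real (m ^ 2)"
      by (rule of_nat_mono)
    then have cells: "(\<Sum>C\<in>Pow ?J. of_bool (?Q C \<noteq> {})) \<le> real m ^ 2"
      by simp
    have card: "(\<Sum>C\<in>Pow ?J. real (card (?Q C))) = real (card P)"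
      using sum_pattern_count[OF P, of ?J mem \<rho>] by (simp add: pattern_count_def flip: of_nat_sum)
    have "(real (card P) - real m ^ 2) / 2 * D
        \<le> (\<Sum>C\<in>Pow ?J. (real (card (?Q C)) - of_bool (?Q C \<noteq> {})) / 2 * D)"
    proof -
      have "(\<Sum>C\<in>Pow ?J. (real (card (?Q C)) - of_bool (?Q C \<noteq> {})) / 2 * D)
        = (real (card P) - (\<Sum>C\<in>Pow ?J. of_bool (?Q C \<noteq> {}))) / 2 * D"
        using card by (simp add: sum_subtractf flip: sum_distrib_right sum_divide_distrib)
      then show ?thesis
        using cells D by (auto intro!: mult_right_mono)
    qed
    also have "\<dots> \<le> (\<Sum>C\<in>Pow ?J. \<Sum>x\<in>L. w x *
        real (min (card {p\<in>?Q C. \<not> mem p x}) (card {p\<in>?Q C. mem p x})))"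
      using P by (intro sum_mono cell_split_lower L w far) auto
    also have "\<dots> = (\<Sum>x\<in>L. \<Sum>C\<in>Pow ?J. w x *
        real (min (card {p\<in>?Q C. \<not> mem p x}) (card {p\<in>?Q C. mem p x})))"
      by (rule sum.swap)
    also have "\<dots> = (\<Sum>x\<in>L. w x * g i (\<rho>(i := x)))"
      unfolding g_def of_nat_sum sum_distrib_left
      by (intro sum.cong refl) (use i in \<open>simp add: pattern_count_upd\<close>)
    finally show "(real (card P) - real m ^ 2) / 2 * D \<le> (\<Sum>x\<in>L. w x * g i (\<rho>(i := x)))" .
  qed (use m in auto)
  then show ?thesis by simp
qed

lemma close_pair:
  fixes w :: "'x \<Rightarrow> real"
  assumes P: "finite P" and n: "2 \<le> card P" and L: "finite L" and w: "\<And>x. x \<in> L \<Longrightarrow> 0 \<le> w x"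
    and vc: "dual_vc2 mem P L"
  shows "\<exists>p\<in>P. \<exists>q\<in>P. p \<noteq> q \<and>
    (\<Sum>x\<in>L. w x * of_bool (mem p x \<noteq> mem q x)) \<le> 23 * sum w L / sqrt (card P)"
proof (rule ccontr)
  define W where "W = sum w L"
  define n where "n = card P"
  define D where "D = 23 * W / sqrt n"
  assume neg: "\<not> ?thesis"
  have far: "D < (\<Sum>x\<in>L. w x * of_bool (mem p x \<noteq> mem q x))" if "p \<in> P" "q \<in> P" "p \<noteq> q" for p q
    using neg that by (force simp: D_def W_def n_def)
  have n2: "n \<ge> 2" using n by (simp add: n_def)
  have W0: "W \<ge> 0" unfolding W_def using w by (intro sum_nonneg)
  have "W \<noteq> 0"
  proof
    assume "W = 0"
    then have z: "\<And>x. x \<in> L \<Longrightarrow> w x = 0"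
      using L w by (simp add: W_def sum_nonneg_eq_0_iff)
    obtain p q where "p \<in> P" "q \<in> P" "p \<noteq> q"
      using n by (metis card_2_iff' obtain_subset_with_card_n subsetD)
    from far[OF this] z \<open>W = 0\<close> show False by (simp add: D_def)
  qed
  with W0 have W: "W > 0" by simp
  \<comment> \<open>As m^2 \<le> n/2, subtracting m^2 keeps half of the points, which yields D \<le>
    8 W / m. Rounding down costs a factor of at most 2 since m \<ge> 1, so sqrt n \<le> 2.84 m; the
    constant 23 is chosen above 8 times 2.84.\<close>
  define m where "m = nat \<lfloor>sqrt (n / 2)\<rfloor>"
  have s1: "sqrt (n / 2) \<ge> 1" using n2 by simp
  have m_le: "real m \<le> sqrt (n / 2)" and m_gt: "sqrt (n / 2) < real m + 1" and m1: "m \<ge> 1"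
    using s1 by (simp_all add: m_def le_nat_iff; linarith)+
  have "real m ^ 2 \<le> sqrt (n / 2) ^ 2"
    using m_le by (intro power_mono) auto
  then have msq: "real m ^ 2 \<le> n / 2" by simp
  have "m * ((real (card P) - real m ^ 2) / 2 * D) \<le> 2 * real (card P) * sum w L"
    using m1 W far by (intro packing_sample[OF P L w _ vc]) (auto simp: W_def D_def less_imp_le)
  then have ineq: "m * ((n - real m ^ 2) / 2 * D) \<le> 2 * real n * W"
    by (simp add: n_def W_def)
  have D0: "D > 0" using W n2 by (simp add: D_def)
  have "m * (n / 4 * D) \<le> m * ((n - real m ^ 2) / 2 * D)"
    using msq D0 by (intro mult_left_mono mult_right_mono) auto
  with ineq have "m * (n / 4 * D) \<le> 2 * real n * W" by (rule order_trans[rotated])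
  then have "real n * (m * D) \<le> real n * (8 * W)" by (simp add: mult_ac)
  then have "m * D \<le> 8 * W" using n2 by simp
  then have "m * 23 \<le> 8 * sqrt n"
    using W n2 by (simp add: D_def field_simps)
  moreover have "sqrt n \<le> 2.84 * real m"
  proof -
    have "sqrt 2 \<le> (1.42::real)" by (rule real_le_lsqrt) (auto simp: power2_eq_square)
    moreover have "sqrt (n / 2) \<le> 2 * m" using m_gt m1 by linarith
    ultimately have "sqrt 2 * sqrt (n / 2) \<le> 1.42 * (2 * m)"
      by (intro mult_mono) auto
    then show ?thesis by (simp flip: real_sqrt_mult)
  qed
  ultimately show False using m1 by simp
qed

subsection \<open>Matchings with low crossing number\<close>

definition crossings :: "('p \<Rightarrow> bool) \<Rightarrow> ('p \<times> 'p) list \<Rightarrow> nat" where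
  "crossings R ps = length (filter (\<lambda>(p, q). R p \<noteq> R q) ps)"

lemma crossings_simps [simp]:
  "crossings R [] = 0"
  "crossings R ((p, q) # ps) = of_bool (R p \<noteq> R q) + crossings R ps"
  by (auto simp: crossings_def)

text \<open>\<open>distinct (endpoints ps)\<close> expresses that the pairs form a matching.\<close>

definition endpoints :: "('p \<times> 'p) list \<Rightarrow> 'p list" where
  "endpoints ps = concat (map (\<lambda>(p, q). [p, q]) ps)"

lemma endpoints_simps [simp]:
  "endpoints [] = []"
  "endpoints ((p, q) # ps) = p # q # endpoints ps"
  by (auto simp: endpoints_def)

text \<open>Greedy choice: take a close pair, double the weight of every range separating it, and
  continue with the remaining points. Ranges crossed often become heavy, so later pairs avoid them.
  The induction needs arbitrary initial weights because doubling changes them.\<close>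

lemma low_crossing_weight:
  fixes w :: "'x \<Rightarrow> real"
  assumes "finite P" and L: "finite L" and "\<And>x. x \<in> L \<Longrightarrow> 0 \<le> w x" and "dual_vc2 mem P L"
  shows "\<exists>ps. distinct (endpoints ps) \<and> set (endpoints ps) \<subseteq> P \<and> card (P - set (endpoints ps)) \<le> 1 \<and>
    (\<Sum>x\<in>L. w x * 2 ^ crossings (\<lambda>p. mem p x) ps) \<le> sum w L * exp (46 * sqrt (card P))"
  using assms
proof (induction "card P" arbitrary: P w rule: less_induct)
  case less
  show ?case
  proof (cases "card P \<le> 1")
    case True
    have "sum w L * 1 \<le> sum w L * exp (46 * sqrt (card P))"
      using less.prems by (intro mult_left_mono sum_nonneg) auto
    then show ?thesis
      using True by (intro exI[of _ "[]"]) simp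
  next
    case False
    define n where "n = card P"
    have n: "2 \<le> n" using False by (simp add: n_def)
    obtain p q where pq: "p \<in> P" "q \<in> P" "p \<noteq> q"
      and close: "(\<Sum>x\<in>L. w x * of_bool (mem p x \<noteq> mem q x)) \<le> 23 * sum w L / sqrt n"
      using close_pair[of P L w mem] less.prems n by (auto simp: n_def)
    define Q where "Q = P - {p, q}"
    define w' where "w' = (\<lambda>x. w x * 2 ^ of_bool (mem p x \<noteq> mem q x))"
    have w'_nonneg: "\<And>x. x \<in> L \<Longrightarrow> 0 \<le> w' x"
      using less.prems by (simp add: w'_def)
    have cardQ: "card Q = n - 2"
      using pq less.prems by (simp add: Q_def n_def card_Diff_subset)
    have finQ: "finite Q" and QP: "Q \<subseteq> P" using less.prems by (auto simp: Q_def)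
    have "card Q < card P" using cardQ n by (simp add: n_def)
    then have "\<exists>ps. distinct (endpoints ps) \<and> set (endpoints ps) \<subseteq> Q \<and> card (Q - set (endpoints ps)) \<le> 1 \<and>
        (\<Sum>x\<in>L. w' x * 2 ^ crossings (\<lambda>p. mem p x) ps) \<le> sum w' L * exp (46 * sqrt (card Q))"
      by (rule less.hyps) (fact finQ L w'_nonneg dual_vc2_subset[OF less.prems(4) QP])+
    then obtain ps where ps: "distinct (endpoints ps)" "set (endpoints ps) \<subseteq> Q" "card (Q - set (endpoints ps)) \<le> 1"
      and le: "(\<Sum>x\<in>L. w' x * 2 ^ crossings (\<lambda>p. mem p x) ps) \<le> sum w' L * exp (46 * sqrt (card Q))"
      by blast
    have W: "0 \<le> sum w L" using less.prems by (intro sum_nonneg)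
    have "sum w' L = sum w L + (\<Sum>x\<in>L. w x * of_bool (mem p x \<noteq> mem q x))"
      unfolding w'_def sum.distrib[symmetric] by (intro sum.cong) auto
    also have "\<dots> \<le> sum w L * (1 + 23 / sqrt n)"
      using close by (simp add: algebra_simps)
    also have "\<dots> \<le> sum w L * exp (23 / sqrt n)"
      using W by (intro mult_left_mono exp_ge_add_one_self)
    finally have w': "sum w' L \<le> sum w L * exp (23 / sqrt n)" .
    define s t where "s = sqrt (real n)" and "t = sqrt (real (n - 2))"
    have s: "s > 0" and t: "t \<ge> 0" using n by (simp_all add: s_def t_def)
    have s2: "s ^ 2 = n" and t2: "t ^ 2 = real n - 2" using n by (simp_all add: s_def t_def of_nat_diff)
    \<comment> \<open>Removing two points lowers sqrt n by at least 1 / sqrt n, so 46 sqrt n drops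
      by enough to pay for the growth 23 / sqrt n of the exponent.\<close>
    have "0 \<le> (s - t) ^ 2" by simp
    then have "2 * s * t \<le> 2 * s ^ 2 - 2"
      using s2 t2 by (simp add: power2_diff)
    then have st: "23 / s + 46 * t \<le> 46 * s"
      using s by (simp add: field_simps power2_eq_square)
    have "(\<Sum>x\<in>L. w x * 2 ^ crossings (\<lambda>p. mem p x) ((p, q) # ps))
        = (\<Sum>x\<in>L. w' x * 2 ^ crossings (\<lambda>p. mem p x) ps)"
      by (simp add: w'_def power_add mult_ac)
    also have "\<dots> \<le> sum w L * exp (23 / sqrt n) * exp (46 * sqrt (card Q))"
      using le w' by (meson exp_ge_zero mult_right_mono order_trans)
    also have "\<dots> = sum w L * exp (23 / s + 46 * t)"
      by (simp add: exp_add s_def t_def cardQ mult.assoc)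
    also have "\<dots> \<le> sum w L * exp (46 * sqrt n)"
      using st W by (intro mult_left_mono) (simp_all add: s_def)
    finally have "(\<Sum>x\<in>L. w x * 2 ^ crossings (\<lambda>p. mem p x) ((p, q) # ps)) \<le> sum w L * exp (46 * sqrt n)" .
    moreover have "P - set (endpoints ((p, q) # ps)) = Q - set (endpoints ps)"
      by (auto simp: Q_def)
    moreover have "distinct (endpoints ((p, q) # ps))" "set (endpoints ((p, q) # ps)) \<subseteq> P"
      using ps(1,2) pq by (auto simp: Q_def)
    ultimately show ?thesis
      using ps(3) by (intro exI[of _ "(p, q) # ps"] conjI) (simp_all only: n_def)
  qed
qed

text \<open>With unit weights, a single range contributes 2 to the power of its crossings to the
  potential; the logarithm of the total bounds this exponent.\<close>

lemma low_crossing_matching: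
  assumes "finite P" and L: "finite L" and vc: "dual_vc2 mem P L"
  obtains ps where "distinct (endpoints ps)" "set (endpoints ps) \<subseteq> P" "card (P - set (endpoints ps)) \<le> 1"
    "\<And>x. x \<in> L \<Longrightarrow> ln 2 * real (crossings (\<lambda>p. mem p x) ps) \<le> ln (card L) + 46 * sqrt (card P)"
proof -
  have "\<exists>ps. distinct (endpoints ps) \<and> set (endpoints ps) \<subseteq> P \<and> card (P - set (endpoints ps)) \<le> 1 \<and>
    (\<Sum>x\<in>L. 1 * 2 ^ crossings (\<lambda>p. mem p x) ps) \<le> (\<Sum>x\<in>L. 1) * exp (46 * sqrt (card P) :: real)"
    by (rule low_crossing_weight[OF assms(1) L zero_le_one vc])
  then obtain ps where ps: "distinct (endpoints ps)" "set (endpoints ps) \<subseteq> P" "card (P - set (endpoints ps)) \<le> 1"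
    and le: "(\<Sum>x\<in>L. 1 * 2 ^ crossings (\<lambda>p. mem p x) ps) \<le> (\<Sum>x\<in>L. 1) * exp (46 * sqrt (card P) :: real)"
    by blast
  have "ln 2 * real (crossings (\<lambda>p. mem p x) ps) \<le> ln (card L) + 46 * sqrt (card P)" if x: "x \<in> L" for x
  proof -
    have "2 ^ crossings (\<lambda>p. mem p x) ps \<le> (\<Sum>x\<in>L. 2 ^ crossings (\<lambda>p. mem p x) ps :: real)"
      using x L by (intro member_le_sum) auto
    also have "\<dots> \<le> card L * exp (46 * sqrt (card P))"
      using le by simp
    finally have "ln (2 ^ crossings (\<lambda>p. mem p x) ps) \<le> ln (card L * exp (46 * sqrt (card P)))"
      by (intro ln_mono) auto
    moreover have "card L > 0" using x L by (auto simp: card_gt_0_iff)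
    ultimately show ?thesis
      by (simp add: ln_mult ln_realpow mult.commute)
  qed
  with ps show ?thesis by (intro that)
qed

section \<open>Choosing the signs of the pairs\<close>

text \<open>A bound on cosh u for averaging over the two signs of a split pair, from exp u \<le> 1 +
  u + u^2 and exp (-u) \<le> 1 / (1 + u). The sharper exponent u^2 / 2 would only improve
  constants.\<close>

lemma exp_add_exp_minus_le:
  fixes u :: real
  assumes "0 \<le> u" "u \<le> 1"
  shows "exp u + exp (-u) \<le> 2 * exp (u ^ 2)"
proof -
  have "exp (-u) = 1 / exp u" by (simp add: exp_minus divide_inverse)
  also have "\<dots> \<le> 1 / (1 + u)"
    using assms by (intro divide_left_mono) auto
  also have "\<dots> \<le> 1 - u + u ^ 2"
  proof -
    have "(1 - u + u ^ 2) * (1 + u) = 1 + u ^ 3"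
      by (simp add: algebra_simps power2_eq_square power3_eq_cube)
    then have "1 \<le> (1 - u + u ^ 2) * (1 + u)" using assms by simp
    then show ?thesis using assms by (simp add: divide_le_eq)
  qed
  finally have "exp u + exp (-u) \<le> 2 * (1 + u ^ 2)"
    using exp_bound[OF assms] by simp
  also have "\<dots> \<le> 2 * exp (u ^ 2)"
    by (intro mult_left_mono exp_ge_add_one_self) auto
  finally show ?thesis .
qed

text \<open>The potential is symmetric in u and -u so that it controls absolute values. The weights
  \<open>v\<close> are general because the induction first absorbs the factor of the head pair into
  them, then colours the tail, and chooses the sign of the head last.\<close>

lemma pair_coloring:
  fixes u :: real and RR :: "'p set set" and v :: "'p set \<Rightarrow> real"
  assumes "\<And>R. R \<in> RR \<Longrightarrow> 0 \<le> v R" and "distinct (endpoints ps)" and u: "0 \<le> u" "u \<le> 1"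
  shows "\<exists>X. X \<in> UNIV \<rightarrow> {-1, 1 :: int} \<and>
    (\<Sum>R\<in>RR. v R * (exp (u * (\<Sum>y\<in>R \<inter> set (endpoints ps). X y)) + exp (- u * (\<Sum>y\<in>R \<inter> set (endpoints ps). X y))))
      \<le> (\<Sum>R\<in>RR. v R * (2 * exp (u ^ 2 * crossings (\<lambda>p. p \<in> R) ps)))"
  using assms(1,2)
proof (induction ps arbitrary: v)
  case Nil
  show ?case by (intro exI[of _ "\<lambda>_. 1"]) simp
next
  case (Cons a ps)
  obtain p q where a: "a = (p, q)" by (cases a)
  let ?E = "set (endpoints ps)" and ?E' = "set (endpoints (a # ps))"
  have pq: "p \<noteq> q" "p \<notin> ?E" "q \<notin> ?E" and dist: "distinct (endpoints ps)"
    using Cons.prems by (auto simp: a)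
  define e :: "'p set \<Rightarrow> real" where "e R = of_bool ((p \<in> R) \<noteq> (q \<in> R))" for R
  define v' where "v' R = v R * exp (u ^ 2 * e R)" for R
  have "\<And>R. R \<in> RR \<Longrightarrow> 0 \<le> v' R" using Cons.prems by (simp add: v'_def)
  from Cons.IH[where v = v', OF this dist] obtain X where X: "X \<in> UNIV \<rightarrow> {-1, 1 :: int}"
    and le: "(\<Sum>R\<in>RR. v' R * (exp (u * (\<Sum>y\<in>R \<inter> ?E. X y)) + exp (- u * (\<Sum>y\<in>R \<inter> ?E. X y))))
      \<le> (\<Sum>R\<in>RR. v' R * (2 * exp (u ^ 2 * crossings (\<lambda>p. p \<in> R) ps)))"
    by blast
  define Z where "Z R = real_of_int (\<Sum>y\<in>R \<inter> ?E. X y)" for R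
  define c :: "'p set \<Rightarrow> real" where "c R = of_bool (p \<in> R) - of_bool (q \<in> R)" for R
  define Y where "Y s = X(p := s, q := - s)" for s
  define F where "F s = (\<Sum>R\<in>RR. v R * (exp (u * (\<Sum>y\<in>R \<inter> ?E'. Y s y)) + exp (- u * (\<Sum>y\<in>R \<inter> ?E'. Y s y))))" for s
  define B where "B = (\<Sum>R\<in>RR. v R * (2 * exp (u ^ 2 * crossings (\<lambda>p. p \<in> R) (a # ps))))"
  have Y: "real_of_int (\<Sum>y\<in>R \<inter> ?E'. Y s y) = Z R + s * c R" for s R
  proof -
    have "(\<Sum>y\<in>R \<inter> ?E'. Y s y) = (\<Sum>y\<in>?E'. if y \<in> R then Y s y else 0)"
      by (subst Int_commute) (rule sum.inter_restrict, simp)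
    also have "\<dots> = (if p \<in> R then s else 0) + ((if q \<in> R then - s else 0) + (\<Sum>y\<in>?E. if y \<in> R then Y s y else 0))"
      using pq by (simp add: a Y_def)
    also have "(\<Sum>y\<in>?E. if y \<in> R then Y s y else 0) = (\<Sum>y\<in>?E. if y \<in> R then X y else 0)"
      using pq by (intro sum.cong refl) (auto simp: Y_def)
    also have "\<dots> = (\<Sum>y\<in>R \<inter> ?E. X y)"
      by (subst Int_commute) (rule sum.inter_restrict[symmetric], simp)
    finally show ?thesis by (simp add: Z_def c_def)
  qed
  \<comment> \<open>Averaging over the sign gives the factor cosh (u c), which is 1 if
    \<open>R\<close> does not split the pair and at most exp (u^2) if it does. One of the two signs
    does no worse than the average.\<close>
  have "F 1 + F (-1) = (\<Sum>R\<in>RR. v R * ((exp (u * Z R) + exp (- u * Z R)) * (exp (u * c R) + exp (- (u * c R)))))"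
    unfolding F_def Y sum.distrib[symmetric]
    by (intro sum.cong refl) (simp add: algebra_simps flip: exp_add)
  also have "\<dots> \<le> (\<Sum>R\<in>RR. v R * ((exp (u * Z R) + exp (- u * Z R)) * (2 * exp (u ^ 2 * e R))))"
  proof (intro sum_mono mult_left_mono Cons.prems)
    fix R
    show "exp (u * c R) + exp (- (u * c R)) \<le> 2 * exp (u ^ 2 * e R)"
      using exp_add_exp_minus_le[OF u] by (auto simp: c_def e_def)
  qed auto
  also have "\<dots> = 2 * (\<Sum>R\<in>RR. v' R * (exp (u * Z R) + exp (- u * Z R)))"
    by (simp add: v'_def sum_distrib_left mult_ac)
  also have "\<dots> \<le> 2 * (\<Sum>R\<in>RR. v' R * (2 * exp (u ^ 2 * crossings (\<lambda>p. p \<in> R) ps)))"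
    using le by (simp add: Z_def)
  also have "(\<Sum>R\<in>RR. v' R * (2 * exp (u ^ 2 * crossings (\<lambda>p. p \<in> R) ps))) = B"
    unfolding B_def
    by (intro sum.cong refl) (simp add: a v'_def e_def distrib_left exp_add mult_ac)
  finally have "F 1 \<le> B \<or> F (-1) \<le> B" by linarith
  then obtain s where "s \<in> {-1, 1}" "F s \<le> B" by blast
  moreover have "Y s \<in> UNIV \<rightarrow> {-1, 1}" if "s \<in> {-1, 1}" for s
    using X that by (auto simp: Y_def Pi_iff)
  ultimately show ?case
    unfolding F_def B_def by blast
qed

subsection \<open>Vertical adjacency of disjoint convex sets\<close>

text \<open>\<open>alive A t\<close> stands for \<open>A\<close> meeting the vertical line at
  abscissa t. Transitivity is demanded only on a common line: if \<open>A\<close> is below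
  \<open>B\<close> and \<open>B\<close> below \<open>C\<close>, then \<open>A\<close> and
  \<open>C\<close> may share no vertical line.\<close>

locale vertical_order =
  fixes P :: "'a set" and alive :: "'a \<Rightarrow> real \<Rightarrow> bool" and below :: "'a \<Rightarrow> 'a \<Rightarrow> bool"
  assumes finite_P: "finite P"
    and interval: "A \<in> P \<Longrightarrow> alive A s \<Longrightarrow> alive A u \<Longrightarrow> s \<le> t \<Longrightarrow> t \<le> u \<Longrightarrow> alive A t"
    and total: "A \<in> P \<Longrightarrow> B \<in> P \<Longrightarrow> A \<noteq> B \<Longrightarrow> alive A t \<Longrightarrow> alive B t \<Longrightarrow> below A B \<or> below B A"
    and asym: "A \<in> P \<Longrightarrow> B \<in> P \<Longrightarrow> below A B \<Longrightarrow> \<not> below B A"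
    and trans: "A \<in> P \<Longrightarrow> B \<in> P \<Longrightarrow> C \<in> P \<Longrightarrow> alive A t \<Longrightarrow> alive B t \<Longrightarrow> alive C t \<Longrightarrow>
      below A B \<Longrightarrow> below B C \<Longrightarrow> below A C"
begin

definition adjacent :: "real \<Rightarrow> 'a \<Rightarrow> 'a \<Rightarrow> bool" where
  "adjacent t A B \<longleftrightarrow> A \<in> P \<and> B \<in> P \<and> alive A t \<and> alive B t \<and> below A B \<and>
     (\<forall>C\<in>P. alive C t \<longrightarrow> \<not> (below A C \<and> below C B))"

lemma adjacent_above:
  assumes "A \<in> P" "B \<in> P" "alive A t" "alive B t" "below A B"
  shows "\<exists>C. adjacent t A C \<and> (C = B \<or> below C B)"
proof -
  define S where "S = {C \<in> P. alive C t \<and> below A C}"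
  have S: "finite S" "S \<noteq> {}" using finite_P assms by (auto simp: S_def)
  have "asymp_on S below" by (auto simp: asymp_on_def S_def dest: asym)
  moreover have "transp_on S below"
    unfolding transp_on_def S_def using trans by blast
  ultimately obtain m where m: "m \<in> S" "\<And>x. x \<in> S \<Longrightarrow> x \<noteq> m \<Longrightarrow> \<not> below x m"
    using Finite_Set.bex_min_element[OF S(1) _ _ S(2), of below] by blast
  have "\<not> below m m" using asym m(1) by (auto simp: S_def)
  then have "adjacent t A m"
    unfolding adjacent_def using m assms(1,3) by (auto simp: S_def)
  moreover have "m = B \<or> below m B"
    using total[of m B t] m assms by (auto simp: S_def)
  ultimately show ?thesis by blast
qed

lemma dual: "vertical_order P alive (\<lambda>A B. below B A)"
proof (unfold_locales, goal_cases)
  case (2 A s u t)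
  then show ?case using interval by blast
next
  case (5 A B C t)
  then show ?case using trans[of C B A t] by blast
qed (use finite_P total asym in blast)+

lemma adjacent_below:
  assumes "A \<in> P" "B \<in> P" "alive A t" "alive B t" "below A B"
  shows "\<exists>C. adjacent t C B \<and> (C = A \<or> below A C)"
proof -
  interpret d: vertical_order P alive "\<lambda>A B. below B A" by (rule dual)
  have "d.adjacent t B C \<longleftrightarrow> adjacent t C B" for C
    unfolding adjacent_def d.adjacent_def by blast
  then show ?thesis using d.adjacent_above[of B A t] assms by blast
qed

lemma adjacent_unique_right: "adjacent t A B \<Longrightarrow> adjacent t A B' \<Longrightarrow> B = B'"
  unfolding adjacent_def using total by blast

lemma adjacent_unique_left: "adjacent t A B \<Longrightarrow> adjacent t A' B \<Longrightarrow> A = A'"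
  unfolding adjacent_def using total by blast

text \<open>The sweep from left to right: a vertical adjacency appears either when one of the two sets
  appears, or when a set that was between them disappears.\<close>

definition charge :: "real set \<Rightarrow> 'a \<times> 'a \<Rightarrow> nat \<times> 'a \<Rightarrow> bool" where
  "charge T e l \<longleftrightarrow> (case (e, l) of ((A, B), (k, C)) \<Rightarrow> \<exists>t\<in>T. adjacent t A B \<and>
     (k = 0 \<and> C = A \<and> (\<forall>s\<in>T. s < t \<longrightarrow> \<not> alive A s) \<or>
      k = 1 \<and> C = B \<and> (\<forall>s\<in>T. s < t \<longrightarrow> \<not> alive B s) \<or>
      k = 2 \<and> \<not> alive C t \<and> (\<exists>u\<in>T. u < t \<and> (\<forall>s\<in>T. u < s \<longrightarrow> t \<le> s) \<and>
        alive A u \<and> alive B u \<and> alive C u \<and> below A C \<and> below C B)))"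

text \<open>Take the first position at which the pair is adjacent. Unless one of the two sets is new
  there, both are alive at the preceding position; not being adjacent then, they had some
  \<open>C\<close> between them, and \<open>C\<close> must have ended.\<close>

lemma charge_exists:
  assumes T: "finite T" and "t \<in> T" "adjacent t A B"
  shows "\<exists>l\<in>{..<3} \<times> P. charge T (A, B) l"
proof -
  let ?T = "{t \<in> T. adjacent t A B}"
  define t0 where "t0 = Min ?T"
  have "finite ?T" "?T \<noteq> {}" using assms by auto
  then have "t0 \<in> ?T" and min: "\<And>s. s \<in> ?T \<Longrightarrow> t0 \<le> s"
    unfolding t0_def by (rule Min_in, simp)
  then have t0: "t0 \<in> T" "adjacent t0 A B" by auto
  then have AB: "A \<in> P" "B \<in> P" "alive A t0" "alive B t0" "below A B"
    by (auto simp: adjacent_def)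
  consider (A) "\<forall>s\<in>T. s < t0 \<longrightarrow> \<not> alive A s" | (B) "\<forall>s\<in>T. s < t0 \<longrightarrow> \<not> alive B s"
    | (C) s s' where "s \<in> T" "s < t0" "alive A s" "s' \<in> T" "s' < t0" "alive B s'"
    by blast
  then show ?thesis
  proof cases
    case A
    then have "charge T (A, B) (0, A)" using t0 by (auto simp: charge_def)
    then show ?thesis using AB by force
  next
    case B
    then have "charge T (A, B) (1, B)" using t0 by (auto simp: charge_def)
    then show ?thesis using AB by force
  next
    case C
    let ?U = "{s \<in> T. s < t0}"
    define u where "u = Max ?U"
    have U: "finite ?U" "?U \<noteq> {}" using T C by auto
    then have u: "u \<in> T" "u < t0" using Max_in[of ?U] by (auto simp: u_def)
    have max: "s \<le> u" if "s \<in> T" "s < t0" for s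
      using that U by (simp add: u_def)
    have alive_u: "alive A u" "alive B u"
      using interval[of A s t0 u] interval[of B s' t0 u] C AB u max by auto
    have "\<not> adjacent u A B" using min[of u] u by auto
    then obtain C where C: "C \<in> P" "alive C u" "below A C" "below C B"
      unfolding adjacent_def using AB alive_u by blast
    have "\<not> alive C t0" using t0(2) C unfolding adjacent_def by blast
    moreover have "\<forall>s\<in>T. u < s \<longrightarrow> t0 \<le> s" using max by force
    ultimately have "charge T (A, B) (2, C)"
      using t0 u alive_u C unfolding charge_def by auto
    then show ?thesis using C by force
  qed
qed

text \<open>A label determines the position: the first one of \<open>C\<close> for k = 0 and 1, the
  one just after its last for k = 2. For k = 2 both pairs enclose \<open>C\<close> at the preceding
  position, so if \<open>A\<close> and \<open>A'\<close> differed, one of them would lie strictly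
  inside the other pair.\<close>

lemma charge_unique:
  assumes T: "finite T" and 1: "charge T e l" and 2: "charge T e' l" and l: "l \<in> {..<3} \<times> P"
  shows "e = e'"
proof -
  obtain A B A' B' k C where eq: "e = (A, B)" "e' = (A', B')" "l = (k, C)" and C: "C \<in> P"
    using l by (cases e, cases e', cases l) auto
  obtain t t' where t: "t \<in> T" "adjacent t A B" and t': "t' \<in> T" "adjacent t' A' B'"
    and c: "k = 0 \<and> C = A \<and> (\<forall>s\<in>T. s < t \<longrightarrow> \<not> alive A s) \<or>
      k = 1 \<and> C = B \<and> (\<forall>s\<in>T. s < t \<longrightarrow> \<not> alive B s) \<or>
      k = 2 \<and> \<not> alive C t \<and> (\<exists>u\<in>T. u < t \<and> (\<forall>s\<in>T. u < s \<longrightarrow> t \<le> s) \<and>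
        alive A u \<and> alive B u \<and> alive C u \<and> below A C \<and> below C B)"
    and c': "k = 0 \<and> C = A' \<and> (\<forall>s\<in>T. s < t' \<longrightarrow> \<not> alive A' s) \<or>
      k = 1 \<and> C = B' \<and> (\<forall>s\<in>T. s < t' \<longrightarrow> \<not> alive B' s) \<or>
      k = 2 \<and> \<not> alive C t' \<and> (\<exists>u\<in>T. u < t' \<and> (\<forall>s\<in>T. u < s \<longrightarrow> t' \<le> s) \<and>
        alive A' u \<and> alive B' u \<and> alive C u \<and> below A' C \<and> below C B')"
    using 1 2 unfolding eq charge_def prod.case by blast
  have al: "alive A t" "alive B t" "alive A' t'" "alive B' t'" 
    and inP: "A \<in> P" "B \<in> P" "A' \<in> P" "B' \<in> P"
    using t t' by (auto simp: adjacent_def)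
  consider "k = 0" | "k = 1" | "k = 2" using c by blast
  then show ?thesis
  proof cases
    case 1
    then have "A = A'" "t = t'" using c c' t t' al by (auto intro: linorder_cases[of t t'])
    then show ?thesis using t t' adjacent_unique_right eq by blast
  next
    case 2
    then have "B = B'" "t = t'" using c c' t t' al by (auto intro: linorder_cases[of t t'])
    then show ?thesis using t t' adjacent_unique_left eq by blast
  next
    case 3
    obtain u where u: "u \<in> T" "u < t" "\<And>s. s \<in> T \<Longrightarrow> u < s \<Longrightarrow> t \<le> s"
      "alive A u" "alive B u" "alive C u" "below A C" "below C B" and Ct: "\<not> alive C t"
      using 3 c by auto
    obtain u' where u': "u' \<in> T" "u' < t'" "\<And>s. s \<in> T \<Longrightarrow> u' < s \<Longrightarrow> t' \<le> s"
      "alive A' u'" "alive B' u'" "alive C u'" "below A' C" "below C B'" and Ct': "\<not> alive C t'"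
      using 3 c' by auto
    have "\<not> u < u'"
      using interval[of C u u' t] u(2) u(3)[of u'] u(6) u'(1,6) C Ct by auto
    moreover have "\<not> u' < u"
      using interval[of C u' u t'] u'(2) u'(3)[of u] u'(6) u(1,6) C Ct' by auto
    ultimately have uu: "u' = u" by simp
    have tt: "t' = t" using u(3)[of t'] u'(3)[of t] u(2) u'(2) t t' uu by simp
    note al' = al[unfolded tt] and u'' = u'(4-8)[unfolded uu]
    have mixed: "below A B'" "below A' B"
      using trans[of A C B' u] trans[of A' C B u] u u'' inP C by blast+
    have "A = A'"
    proof (rule ccontr)
      assume "A \<noteq> A'"
      then have "below A A' \<or> below A' A" using total inP al' by blast
      then show False
      proof
        assume "below A A'"
        then show False using t(2) mixed(2) inP al' unfolding adjacent_def by blast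
      next
        assume "below A' A"
        then show False using t'(2) mixed(1) inP al' unfolding adjacent_def tt by blast
      qed
    qed
    then show ?thesis using t t' adjacent_unique_right eq tt by blast
  qed
qed

lemma card_adjacent_le:
  assumes T: "finite T"
  shows "card {(A, B). \<exists>t\<in>T. adjacent t A B} \<le> 3 * card P"
proof -
  have "card {(A, B). \<exists>t\<in>T. adjacent t A B} \<le> card ({..<3::nat} \<times> P)"
    by (rule card_le_if_inj_on_rel[where r = "charge T"])
       (use finite_P charge_exists[OF T] charge_unique[OF T] in blast)+
  then show ?thesis by (simp add: card_cartesian_product)
qed

definition neighbours :: "real set \<Rightarrow> 'a \<Rightarrow> 'a set" where
  "neighbours T A = {B. \<exists>t\<in>T. adjacent t A B \<or> adjacent t B A}"

text \<open>Each adjacency is counted once at its lower and once at its upper member, so the average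
  number of neighbours is at most 2 times 3.\<close>

lemma few_neighbours:
  assumes T: "finite T" and "P \<noteq> {}"
  shows "\<exists>A\<in>P. card (neighbours T A) \<le> 6"
proof (rule ccontr)
  assume "\<not> ?thesis"
  then have many: "7 \<le> card (neighbours T A)" if "A \<in> P" for A
    using that by force
  define E where "E = {(A, B). \<exists>t\<in>T. adjacent t A B}"
  define up where "up A = {B. (A, B) \<in> E}" for A
  define dn where "dn A = {B. (B, A) \<in> E}" for A
  have E: "E \<subseteq> P \<times> P" by (auto simp: E_def adjacent_def)
  have fin: "finite (up A)" "finite (dn A)" for A
    using E finite_P by (auto intro: finite_subset[of _ P] simp: up_def dn_def)
  have up: "(\<Sum>A\<in>P. card (up A)) = card E"
  proof -
    have "card (SIGMA A:P. up A) = (\<Sum>A\<in>P. card (up A))"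
      using finite_P fin by (intro card_SigmaI) auto
    moreover have "(SIGMA A:P. up A) = E" using E by (auto simp: up_def)
    ultimately show ?thesis by simp
  qed
  have dn: "(\<Sum>A\<in>P. card (dn A)) = card E"
  proof -
    have "card (SIGMA A:P. dn A) = (\<Sum>A\<in>P. card (dn A))"
      using finite_P fin by (intro card_SigmaI) auto
    moreover have "prod.swap ` (SIGMA A:P. dn A) = E" using E by (auto simp: dn_def image_def)
    moreover have "card (prod.swap ` (SIGMA A:P. dn A)) = card (SIGMA A:P. dn A)"
      by (rule card_image) simp
    ultimately show ?thesis by simp
  qed
  have "7 * card P = (\<Sum>A\<in>P. 7)" by simp
  also have "\<dots> \<le> (\<Sum>A\<in>P. card (up A) + card (dn A))"
  proof (rule sum_mono)
    fix A assume "A \<in> P"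
    have "neighbours T A = up A \<union> dn A"
      by (auto simp: neighbours_def up_def dn_def E_def)
    then show "7 \<le> card (up A) + card (dn A)"
      using many[OF \<open>A \<in> P\<close>] card_Un_le[of "up A" "dn A"] by simp
  qed
  also have "\<dots> \<le> 2 * (3 * card P)"
    using card_adjacent_le[OF T] up dn by (simp add: sum.distrib E_def)
  finally have "card P = 0" by simp
  then show False using finite_P \<open>P \<noteq> {}\<close> by simp
qed

end

section \<open>Disjoint convex hulls in the plane\<close>

text \<open>A single vertical line meeting both sets fixes the sign of the vertical component of the
  normal, and thereby the order on every other common vertical line.\<close>

lemma separator_orientation:
  fixes X Y :: "(real^2) set"
  assumes X: "\<And>x. x \<in> X \<Longrightarrow> a \<bullet> x < c" and Y: "\<And>y. y \<in> Y \<Longrightarrow> c < a \<bullet> y"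
    and pq: "p \<in> X" "q \<in> Y" "p $ 1 = q $ 1" "p $ 2 < q $ 2"
  shows "0 < a $ 2"
proof -
  have "a \<bullet> p < a \<bullet> q" using X[OF pq(1)] Y[OF pq(2)] by simp
  then have "a $ 2 * p $ 2 < a $ 2 * q $ 2"
    using pq(3) by (simp add: inner_vec_def sum_2)
  then have "0 < a $ 2 * (q $ 2 - p $ 2)" by (simp add: algebra_simps)
  then show ?thesis using pq(4) by (simp add: zero_less_mult_iff)
qed

lemma hull_separator:
  fixes A B :: "(real^2) set"
  assumes "finite A" "finite B" "A \<noteq> {}" "B \<noteq> {}" "disjnt (convex hull A) (convex hull B)"
  obtains a c where "\<And>x. x \<in> convex hull A \<Longrightarrow> a \<bullet> x < c" "\<And>y. y \<in> convex hull B \<Longrightarrow> c < a \<bullet> y"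
proof -
  have "\<exists>a c. (\<forall>x\<in>convex hull A. a \<bullet> x < c) \<and> (\<forall>x\<in>convex hull B. c < a \<bullet> x)"
    using assms by (intro separating_hyperplane_closed_compact)
      (auto simp: disjnt_def finite_imp_compact_convex_hull compact_imp_closed)
  then show ?thesis using that by blast
qed

text \<open>One common vertical line serves as witness; \<open>vert_below_all\<close> extends the
  order to all of them. \<open>A \<noteq> B\<close> keeps the relation irreflexive, as a hull may
  contain two points of one vertical line.\<close>

definition vert_below :: "(real^2) set \<Rightarrow> (real^2) set \<Rightarrow> bool" where
  "vert_below A B \<longleftrightarrow> A \<noteq> B \<and> (\<exists>p\<in>convex hull A. \<exists>q\<in>convex hull B. p $ 1 = q $ 1 \<and> p $ 2 < q $ 2)"

lemma vert_below_all:
  assumes AB: "finite A" "finite B" "A \<noteq> {}" "B \<noteq> {}" "disjnt (convex hull A) (convex hull B)"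
    and "vert_below A B" and p: "p \<in> convex hull A" and q: "q \<in> convex hull B" and eq: "p $ 1 = q $ 1"
  shows "p $ 2 < q $ 2"
proof -
  obtain a c where ac: "\<And>x. x \<in> convex hull A \<Longrightarrow> a \<bullet> x < c" "\<And>y. y \<in> convex hull B \<Longrightarrow> c < a \<bullet> y"
    using hull_separator[OF AB] by blast
  obtain p' q' where "p' \<in> convex hull A" "q' \<in> convex hull B" "p' $ 1 = q' $ 1" "p' $ 2 < q' $ 2"
    using \<open>vert_below A B\<close> unfolding vert_below_def by blast
  then have pos: "0 < a $ 2" using separator_orientation[OF ac] by blast
  have "a \<bullet> p < a \<bullet> q" using ac(1)[OF p] ac(2)[OF q] by simp
  then have "a $ 2 * p $ 2 < a $ 2 * q $ 2"
    using eq by (simp add: inner_vec_def sum_2)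
  then show ?thesis using pos by simp
qed

definition traces :: "(real^2) set \<Rightarrow> (real^2) set set" where
  "traces S = {S \<inter> {x. a \<bullet> x \<le> b} | a b. True}"

lemma vertical_order_hulls:
  fixes P :: "(real^2) set set"
  assumes P: "finite P" and fin: "\<And>A. A \<in> P \<Longrightarrow> finite A" and ne: "\<And>A. A \<in> P \<Longrightarrow> A \<noteq> {}"
    and disj: "\<And>A B. A \<in> P \<Longrightarrow> B \<in> P \<Longrightarrow> A \<noteq> B \<Longrightarrow> disjnt (convex hull A) (convex hull B)"
  shows "vertical_order P (\<lambda>A t. \<exists>p\<in>convex hull A. p $ 1 = t) vert_below"
proof
  show "finite P" by fact
  have all: "p $ 2 < q $ 2" if "A \<in> P" "B \<in> P" "vert_below A B" "p \<in> convex hull A" "q \<in> convex hull B" "p $ 1 = q $ 1"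
    for A B p q
  proof -
    have "A \<noteq> B" using that(3) by (simp add: vert_below_def)
    then show ?thesis using vert_below_all[of A B p q] that fin ne disj by blast
  qed
  show asym: "\<not> vert_below B A" if "A \<in> P" "B \<in> P" "vert_below A B" for A B
  proof
    assume "vert_below B A"
    then obtain p q where "p \<in> convex hull B" "q \<in> convex hull A" "p $ 1 = q $ 1" "p $ 2 < q $ 2"
      unfolding vert_below_def by blast
    then show False using all[OF that, of q p] by simp
  qed
  show "vert_below A B \<or> vert_below B A"
    if AB: "A \<in> P" "B \<in> P" "A \<noteq> B" and ex: "\<exists>p\<in>convex hull A. p $ 1 = t" "\<exists>p\<in>convex hull B. p $ 1 = t" for A B t
  proof -
    obtain p q where pq: "p \<in> convex hull A" "q \<in> convex hull B" "p $ 1 = q $ 1"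
      using ex by metis
    then have "p \<noteq> q" using disj[OF AB] by (auto simp: disjnt_iff)
    then have "p $ 2 \<noteq> q $ 2" using pq by (simp add: vec_eq_iff forall_2)
    then show ?thesis using pq AB(3) unfolding vert_below_def by (metis linorder_neqE)
  qed
  show "vert_below A C"
    if ABC: "A \<in> P" "B \<in> P" "C \<in> P" and ex: "\<exists>p\<in>convex hull A. p $ 1 = t" "\<exists>p\<in>convex hull B. p $ 1 = t"
      "\<exists>p\<in>convex hull C. p $ 1 = t" and bel: "vert_below A B" "vert_below B C" for A B C t
  proof -
    obtain p where p: "p \<in> convex hull A" "p $ 1 = t" using ex by blast
    obtain q where q: "q \<in> convex hull B" "q $ 1 = t" using ex by blast
    obtain r where r: "r \<in> convex hull C" "r $ 1 = t" using ex by blast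
    have "p $ 2 < q $ 2" "q $ 2 < r $ 2"
      using all[of A B p q] all[of B C q r] ABC bel p q r by auto
    moreover have "A \<noteq> C" using asym ABC bel by blast
    ultimately show ?thesis using p r unfolding vert_below_def by force
  qed
  show "\<exists>p\<in>convex hull A. p $ 1 = t"
    if "\<exists>p\<in>convex hull A. p $ 1 = s" "\<exists>p\<in>convex hull A. p $ 1 = u" "s \<le> t" "t \<le> u"
    for A :: "(real^2) set" and s u t
  proof -
    have "linear (\<lambda>x::real^2. x $ 1)"
      by (rule bounded_linear.linear[OF bounded_linear_vec_nth])
    then have "convex ((\<lambda>x::real^2. x $ 1) ` (convex hull A))"
      by (intro convex_linear_image) auto
    then have "is_interval ((\<lambda>x::real^2. x $ 1) ` (convex hull A))"
      by (simp add: is_interval_convex_1)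
    moreover have "s \<in> (\<lambda>x::real^2. x $ 1) ` (convex hull A)" "u \<in> (\<lambda>x::real^2. x $ 1) ` (convex hull A)"
      using that(1,2) by auto
    ultimately have "t \<in> (\<lambda>x::real^2. x $ 1) ` (convex hull A)"
      using that(3,4) by (meson is_interval_1)
    then show ?thesis by auto
  qed
qed

text \<open>Suppose a point p of another piece \<open>B\<close> satisfies all constraints. The
  vertical line through p meets the hull of \<open>A\<close>; let \<open>C\<close> be the neighbour
  of \<open>A\<close> there on the side of \<open>B\<close>. Either \<open>C = B\<close>, or
  \<open>C\<close> lies between \<open>A\<close> and p; in both cases p is on the far side of the
  separator of \<open>A\<close> and \<open>C\<close>.\<close>

lemma simple_piece:
  assumes S: "finite S" "S \<noteq> {}" and P: "convex_partition S P"
  obtains A H where "A \<in> P" "H \<subseteq> traces S" "finite H" "card H \<le> 8" "A = S \<inter> \<Inter>H"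
proof -
  let ?alive = "\<lambda>A t. \<exists>p\<in>convex hull A. p $ 1 = t"
  have fP: "finite P" "P \<noteq> {}"
    using convex_partition_finite_nonempty[OF S P] by auto
  have part: "\<Union>P = S" and ne: "\<And>A. A \<in> P \<Longrightarrow> A \<noteq> {}"
    using P by (auto simp: convex_partition_def partition_on_def)
  have sub: "A \<subseteq> S" if "A \<in> P" for A
    using part that by auto
  have fin: "finite A" if "A \<in> P" for A
    using sub[OF that] S(1) by (rule finite_subset)
  have disj: "disjnt (convex hull A) (convex hull B)" if "A \<in> P" "B \<in> P" "A \<noteq> B" for A B
    using P that by (auto simp: convex_partition_def pairwise_def)
  interpret vertical_order P ?alive vert_below
    by (rule vertical_order_hulls[OF fP(1) fin ne disj])
  \<comment> \<open>Only points of \<open>S\<close> have to be excluded, so a sweep over their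
    abscissae is enough.\<close>
  define T where "T = (\<lambda>p. p $ 1) ` S"
  have T: "finite T" using S by (simp add: T_def)
  obtain A where A: "A \<in> P" and few: "card (neighbours T A) \<le> 6"
    using few_neighbours[OF T fP(2)] by blast
  have nb: "neighbours T A \<subseteq> P - {A}"
    using asym by (auto simp: neighbours_def adjacent_def)
  have "\<exists>ac. (\<forall>x\<in>convex hull A. fst ac \<bullet> x < snd ac) \<and> (\<forall>y\<in>convex hull B. snd ac < fst ac \<bullet> y)"
    if "B \<in> neighbours T A" for B
  proof -
    have B: "B \<in> P" "A \<noteq> B" using nb that by auto
    obtain a c where "\<And>x. x \<in> convex hull A \<Longrightarrow> a \<bullet> x < c" "\<And>y. y \<in> convex hull B \<Longrightarrow> c < a \<bullet> y"
      using hull_separator[OF fin[OF A] fin[OF B(1)] ne[OF A] ne[OF B(1)] disj[OF A B]] by blast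
    then show ?thesis by (intro exI[of _ "(a, c)"]) simp
  qed
  then have "\<exists>f. \<forall>B\<in>neighbours T A. (\<forall>x\<in>convex hull A. fst (f B) \<bullet> x < snd (f B)) \<and>
      (\<forall>y\<in>convex hull B. snd (f B) < fst (f B) \<bullet> y)"
    by (intro bchoice ballI)
  then obtain f where f: "\<forall>B\<in>neighbours T A. (\<forall>x\<in>convex hull A. fst (f B) \<bullet> x < snd (f B)) \<and>
      (\<forall>y\<in>convex hull B. snd (f B) < fst (f B) \<bullet> y)" ..
  define a c where "a B = fst (f B)" and "c B = snd (f B)" for B
  have sepA: "a B \<bullet> x < c B" if "B \<in> neighbours T A" "x \<in> convex hull A" for B x
    using f that by (simp add: a_def c_def)
  have sepB: "c B < a B \<bullet> x" if "B \<in> neighbours T A" "x \<in> convex hull B" for B x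
    using f that by (simp add: a_def c_def)
  define lo where "lo = Min ((\<lambda>p. p $ 1) ` A)"
  define hi where "hi = Max ((\<lambda>p. p $ 1) ` A)"
  have fA: "finite ((\<lambda>p. p $ 1) ` A)" "(\<lambda>p. p $ 1) ` A \<noteq> {}"
    using fin[OF A] ne[OF A] by auto
  have lohi: "lo \<le> p $ 1" "p $ 1 \<le> hi" if "p \<in> A" for p
    using fA that by (auto simp: lo_def hi_def)
  have "lo \<in> (\<lambda>p. p $ 1) ` A" "hi \<in> (\<lambda>p. p $ 1) ` A"
    unfolding lo_def hi_def using fA by (blast intro: Min_in Max_in)+
  then have alive_lohi: "?alive A lo" "?alive A hi"
    using hull_subset[of A convex] by blast+
  define tr where "tr = (\<lambda>(a::real^2) b. S \<inter> {x. a \<bullet> x \<le> b})"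
  \<comment> \<open>The strip between the extreme abscissae of \<open>A\<close>, on which every
    vertical line meets its hull, and one half-plane per neighbour: 2 + 6 = 8.\<close>
  define H where "H = {tr (- axis 1 1) (- lo), tr (axis 1 1) hi} \<union> (\<lambda>B. tr (a B) (c B)) ` neighbours T A"
  have finN: "finite (neighbours T A)"
    using nb fP(1) by (meson finite_Diff finite_subset)
  have "tr a b \<in> traces S" for a b by (auto simp: traces_def tr_def)
  then have H: "H \<subseteq> traces S" "finite H"
    using finN by (auto simp: H_def)
  have "card H \<le> card {tr (- axis 1 1) (- lo), tr (axis 1 1) hi} + card ((\<lambda>B. tr (a B) (c B)) ` neighbours T A)"
    unfolding H_def by (rule card_Un_le)
  also have "\<dots> \<le> 2 + 6"
    using few card_image_le[OF finN, of "\<lambda>B. tr (a B) (c B)"]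
    by (intro add_mono) (auto simp: card_insert_if)
  finally have card: "card H \<le> 8" by simp
  have "A \<subseteq> S \<inter> \<Inter>H"
    using sub[OF A] lohi sepA hull_subset[of A convex]
    by (fastforce simp: H_def tr_def inner_axis' less_imp_le)
  moreover have "p \<in> A" if p: "p \<in> S \<inter> \<Inter>H" for p
  proof (rule ccontr)
    assume "p \<notin> A"
    obtain B where B: "B \<in> P" "p \<in> B" using p part by auto
    have AB: "A \<noteq> B" using B \<open>p \<notin> A\<close> by auto
    have pB: "p \<in> convex hull B" using B hull_subset[of B convex] by auto
    let ?t = "p $ 1"
    have t: "?t \<in> T" using p by (auto simp: T_def)
    have "lo \<le> ?t" "?t \<le> hi" using p by (auto simp: H_def tr_def inner_axis')
    then have aA: "?alive A ?t" using interval[OF A alive_lohi] by blast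
    then obtain r where r: "r \<in> convex hull A" "r $ 1 = ?t" by blast
    have aB: "?alive B ?t" using pB by blast
    have pC: "a C \<bullet> p \<le> c C" if "C \<in> neighbours T A" for C
    proof -
      have "tr (a C) (c C) \<in> H" using that by (simp add: H_def)
      then have "p \<in> tr (a C) (c C)" using p by blast
      then show ?thesis by (simp add: tr_def)
    qed
    consider "vert_below A B" | "vert_below B A" using total[OF A B(1) AB aA aB] by blast
    then show False
    proof cases
      case 1
      from adjacent_above[OF A B(1) aA aB this] obtain C
        where C: "adjacent ?t A C" "C = B \<or> vert_below C B" by blast
      have CN: "C \<in> neighbours T A" using C t by (auto simp: neighbours_def)
      have CP: "C \<in> P" "vert_below A C" using C by (auto simp: adjacent_def)
      show False
      proof (cases "C = B")
        case True
        then show False using pC[OF CN] sepB[OF CN, of p] pB by simp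
      next
        case False
        then have below: "vert_below C B" using C by blast
        obtain q where q: "q \<in> convex hull C" "q $ 1 = ?t" using C(1) by (auto simp: adjacent_def)
        have qp: "q $ 2 < p $ 2"
          using vert_below_all[OF fin fin ne ne disj below q(1) pB q(2)] CP B False by blast
        have rq: "r $ 2 < q $ 2"
          using vert_below_all[OF fin fin ne ne disj CP(2) r(1) q(1)] A CP CN nb r q by auto
        have "0 < a C $ 2"
          using separator_orientation[OF sepA[OF CN] sepB[OF CN] r(1) q(1)] r q rq by simp
        then have "a C \<bullet> q < a C \<bullet> p"
          using q qp by (simp add: inner_vec_def sum_2)
        then show False using pC[OF CN] sepB[OF CN q(1)] by simp
      qed
    next
      case 2
      from adjacent_below[OF B(1) A aB aA this] obtain C
        where C: "adjacent ?t C A" "C = B \<or> vert_below B C" by blast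
      have CN: "C \<in> neighbours T A" using C t by (auto simp: neighbours_def)
      have CP: "C \<in> P" "vert_below C A" using C by (auto simp: adjacent_def)
      show False
      proof (cases "C = B")
        case True
        then show False using pC[OF CN] sepB[OF CN, of p] pB by simp
      next
        case False
        then have below: "vert_below B C" using C by blast
        obtain q where q: "q \<in> convex hull C" "q $ 1 = ?t" using C(1) by (auto simp: adjacent_def)
        have qp: "p $ 2 < q $ 2"
          using vert_below_all[OF fin fin ne ne disj below pB q(1)] CP B False q by auto
        have rq: "q $ 2 < r $ 2"
          using vert_below_all[OF fin fin ne ne disj CP(2) q(1) r(1)] A CP CN nb r q by auto
        \<comment> \<open>Here \<open>C\<close> is the lower set, so the separator is negated to
          exchange the roles of \<open>A\<close> and \<open>C\<close>.\<close>
        have "0 < (- a C) $ 2"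
          by (rule separator_orientation[of "convex hull C" "- a C" "- c C" "convex hull A" q r])
             (use sepA[OF CN] sepB[OF CN] r q rq in auto)
        then have "a C \<bullet> q < a C \<bullet> p"
          using q qp by (simp add: inner_vec_def sum_2)
        then show False using pC[OF CN] sepB[OF CN q(1)] by simp
      qed
    qed
  qed
  ultimately have "A = S \<inter> \<Inter>H" by blast
  with A H card show ?thesis using that by blast
qed

subsection \<open>Half-planes\<close>

text \<open>The coefficients in \<open>cross\<close> are the minors of Cramer's rule. If all vanish,
  the vectors are parallel, and a nonzero coordinate of \<open>a1\<close> yields a relation between
  \<open>a1\<close> and \<open>a2\<close>.\<close>

lemma planar_dependence:
  fixes a1 a2 a3 :: "real^2"
  shows "\<exists>c1 c2 c3 :: real. (c1 \<noteq> 0 \<or> c2 \<noteq> 0 \<or> c3 \<noteq> 0) \<and> c1 *\<^sub>R a1 + c2 *\<^sub>R a2 + c3 *\<^sub>R a3 = 0"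
proof -
  let ?d = "\<lambda>u v :: real^2. u $ 1 * v $ 2 - u $ 2 * v $ 1"
  have cross: "?d a2 a3 *\<^sub>R a1 + ?d a3 a1 *\<^sub>R a2 + ?d a1 a2 *\<^sub>R a3 = 0"
    by (simp add: vec_eq_iff forall_2 algebra_simps)
  show ?thesis
  proof (cases "?d a2 a3 = 0 \<and> ?d a3 a1 = 0 \<and> ?d a1 a2 = 0")
    case False
    then show ?thesis using cross by blast
  next
    case True
    show ?thesis
    proof (cases "a1 = 0")
      case True
      then show ?thesis by (intro exI[of _ 1] exI[of _ 0]) simp
    next
      case False
      have 1: "a2 $ 1 *\<^sub>R a1 + (- (a1 $ 1)) *\<^sub>R a2 + 0 *\<^sub>R a3 = 0"
        and 2: "a2 $ 2 *\<^sub>R a1 + (- (a1 $ 2)) *\<^sub>R a2 + 0 *\<^sub>R a3 = 0"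
        using True by (simp_all add: vec_eq_iff forall_2 mult.commute)
      have "a1 $ 1 \<noteq> 0 \<or> a1 $ 2 \<noteq> 0" using False by (simp add: vec_eq_iff forall_2)
      then show ?thesis
      proof
        assume "a1 $ 1 \<noteq> 0"
        then show ?thesis
          using 1 by (intro exI[of _ "a2 $ 1"] exI[of _ "- (a1 $ 1)"] exI[of _ 0] conjI) simp_all
      next
        assume "a1 $ 2 \<noteq> 0"
        then show ?thesis
          using 2 by (intro exI[of _ "a2 $ 2"] exI[of _ "- (a1 $ 2)"] exI[of _ 0] conjI) simp_all
      qed
    qed
  qed
qed

text \<open>Three affine functions and the constant \<open>1\<close> on the plane are linearly dependent, which rules
  out one of the eight sign patterns.\<close>

lemma dual_vc2_traces: "dual_vc2 (\<in>) S (traces S)"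
  unfolding dual_vc2_def
proof (intro ballI)
  fix x1 x2 x3 assume "x1 \<in> traces S" "x2 \<in> traces S" "x3 \<in> traces S"
  then obtain a1 b1 a2 b2 a3 b3 where x:
    "x1 = S \<inter> {x. a1 \<bullet> x \<le> b1}" "x2 = S \<inter> {x. a2 \<bullet> x \<le> b2}" "x3 = S \<inter> {x. a3 \<bullet> x \<le> b3}"
    unfolding traces_def by blast
  obtain c1 c2 c3 :: real where c: "c1 \<noteq> 0 \<or> c2 \<noteq> 0 \<or> c3 \<noteq> 0"
    and dep: "c1 *\<^sub>R a1 + c2 *\<^sub>R a2 + c3 *\<^sub>R a3 = 0"
    using planar_dependence by blast
  define c0 where "c0 = c1 * b1 + c2 * b2 + c3 * b3"
  have const: "c1 * (b1 - a1 \<bullet> p) + c2 * (b2 - a2 \<bullet> p) + c3 * (b3 - a3 \<bullet> p) = c0" for p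
  proof -
    have "(c1 *\<^sub>R a1 + c2 *\<^sub>R a2 + c3 *\<^sub>R a3) \<bullet> p = 0" using dep by simp
    then show ?thesis by (simp add: c0_def inner_add_left algebra_simps)
  qed
  show "\<exists>s1 s2 s3. \<forall>p\<in>S. \<not> ((p \<in> x1) = s1 \<and> (p \<in> x2) = s2 \<and> (p \<in> x3) = s3)"
  proof (rule ccontr)
    assume "\<not> ?thesis"
    then have ex: "\<exists>p\<in>S. (p \<in> x1) = s1 \<and> (p \<in> x2) = s2 \<and> (p \<in> x3) = s3" for s1 s2 s3
      by (simp only: not_ex not_all Set.ball_simps not_not)
    \<comment> \<open>Points realising the sign patterns of c and of -c force
      \<open>c0 \<le> 0\<close> and \<open>0 \<le> c0\<close>. Membership in a closed half-plane
      allows a zero value, so strictness holds only for coefficients of one sign; the two patterns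
      together cover any nonzero coefficient.\<close>
    have nonpos: "d * g \<le> 0 \<and> (0 < d \<longrightarrow> d * g < 0)" if "(0 \<le> g) = (d \<le> 0)" for d g :: real
      using that by (auto simp: mult_le_0_iff mult_less_0_iff)
    from ex[of "c1 \<le> 0" "c2 \<le> 0" "c3 \<le> 0"]
    obtain p where p: "p \<in> S" "(p \<in> x1) = (c1 \<le> 0)" "(p \<in> x2) = (c2 \<le> 0)" "(p \<in> x3) = (c3 \<le> 0)"
      by (elim bexE conjE)
    have le: "c0 \<le> 0 \<and> (0 < c1 \<or> 0 < c2 \<or> 0 < c3 \<longrightarrow> c0 < 0)"
    proof -
      have "(0 \<le> b1 - a1 \<bullet> p) = (c1 \<le> 0)" "(0 \<le> b2 - a2 \<bullet> p) = (c2 \<le> 0)" "(0 \<le> b3 - a3 \<bullet> p) = (c3 \<le> 0)"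
        using p by (simp_all add: x)
      note this[THEN nonpos]
      then show ?thesis using const[of p] by linarith
    qed
    from ex[of "- c1 \<le> 0" "- c2 \<le> 0" "- c3 \<le> 0"]
    obtain q where q: "q \<in> S" "(q \<in> x1) = (- c1 \<le> 0)" "(q \<in> x2) = (- c2 \<le> 0)" "(q \<in> x3) = (- c3 \<le> 0)"
      by (elim bexE conjE)
    have ge: "0 \<le> c0 \<and> (c1 < 0 \<or> c2 < 0 \<or> c3 < 0 \<longrightarrow> 0 < c0)"
    proof -
      have "(0 \<le> b1 - a1 \<bullet> q) = (- c1 \<le> 0)" "(0 \<le> b2 - a2 \<bullet> q) = (- c2 \<le> 0)" "(0 \<le> b3 - a3 \<bullet> q) = (- c3 \<le> 0)"
        using q by (simp_all add: x)
      note this[THEN nonpos]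
      then show ?thesis using const[of q] by (simp only: mult_minus_left) linarith
    qed
    from le ge c show False by linarith
  qed
qed

lemma finite_traces: "finite S \<Longrightarrow> finite (traces S)"
  by (rule finite_subset[of _ "Pow S"]) (auto simp: traces_def)

lemma self_in_traces: "S \<in> traces S"
  unfolding traces_def by (rule CollectI, rule exI[of _ 0], rule exI[of _ 0]) simp

text \<open>By Radon's theorem no half-plane cuts out one side of a suitable split of four points,
  so the primal VC dimension is at most 3. Only the logarithm of this count enters the final
  bound.\<close>

lemma card_traces_le:
  assumes S: "finite S"
  shows "card (traces S) \<le> (card S + 1) ^ 3"
proof -
  have "vc_le 3 S (\<lambda>C. of_bool (C \<in> traces S))"
    unfolding vc_le_def
  proof (intro allI impI)
    fix A assume A: "A \<subseteq> S"
      and sh: "\<forall>B\<subseteq>A. \<exists>C\<subseteq>S. 0 < (of_bool (C \<in> traces S) :: nat) \<and> C \<inter> A = B"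
    show "card A \<le> 3"
    proof (rule ccontr)
      assume "\<not> card A \<le> 3"
      then have "affine_dependent A"
        using A S by (intro affine_dependent_biggerset) (auto intro: finite_subset)
      then obtain M P where MP: "M \<subseteq> A" "P \<subseteq> A" "M \<inter> P = {}" "convex hull M \<inter> convex hull P \<noteq> {}"
        by (rule Radon)
      obtain C where C: "C \<in> traces S" "C \<inter> A = M" using sh MP(1) by auto
      then obtain a b where ab: "C = S \<inter> {x. a \<bullet> x \<le> b}" by (auto simp: traces_def)
      have "convex hull M \<subseteq> {x. a \<bullet> x \<le> b}"
        using C ab by (intro hull_minimal convex_halfspace_le) auto
      moreover have "convex hull P \<subseteq> {x. a \<bullet> x > b}"
        using C ab MP A by (intro hull_minimal convex_halfspace_gt) force
      ultimately show False using MP(4) by fastforce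
    qed
  qed
  then have "(\<Sum>C\<in>Pow S. of_bool (C \<in> traces S)) \<le> (card S + 1) ^ 3"
    using S by (intro sauer) auto
  moreover have "(\<Sum>C\<in>Pow S. of_bool (C \<in> traces S)) = card (traces S)"
  proof -
    have "Pow S \<inter> traces S = traces S" by (auto simp: traces_def)
    then show ?thesis using S by (simp add: Int_def[symmetric] sum_of_bool_eq)
  qed
  ultimately show ?thesis by simp
qed

lemma crossings_Inter_le:
  assumes "finite H" "set (endpoints ps) \<subseteq> S"
  shows "crossings (\<lambda>p. p \<in> S \<inter> \<Inter>H) ps \<le> (\<Sum>h\<in>H. crossings (\<lambda>p. p \<in> h) ps)"
  using assms(2)
proof (induction ps)
  case Nil
  then show ?case by simp
next
  case (Cons a ps)
  obtain p q where a: "a = (p, q)" by (cases a)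
  have "of_bool ((p \<in> S \<inter> \<Inter>H) \<noteq> (q \<in> S \<inter> \<Inter>H)) \<le> (\<Sum>h\<in>H. of_bool ((p \<in> h) \<noteq> (q \<in> h)) :: nat)"
  proof (cases "(p \<in> S \<inter> \<Inter>H) \<noteq> (q \<in> S \<inter> \<Inter>H)")
    case True
    have "p \<in> S" "q \<in> S" using Cons.prems by (simp_all add: a)
    then obtain h where h: "h \<in> H" "(p \<in> h) \<noteq> (q \<in> h)" using True by blast
    have "(of_bool ((p \<in> h) \<noteq> (q \<in> h)) :: nat) \<le> (\<Sum>h\<in>H. of_bool ((p \<in> h) \<noteq> (q \<in> h)))"
      using h(1) assms(1) by (intro member_le_sum) auto
    then show ?thesis using h True by simp
  qed simp
  moreover have "crossings (\<lambda>p. p \<in> S \<inter> \<Inter>H) ps \<le> (\<Sum>h\<in>H. crossings (\<lambda>p. p \<in> h) ps)"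
    using Cons by (simp add: a)
  ultimately have "of_bool ((p \<in> S \<inter> \<Inter>H) \<noteq> (q \<in> S \<inter> \<Inter>H)) + crossings (\<lambda>p. p \<in> S \<inter> \<Inter>H) ps
      \<le> (\<Sum>h\<in>H. of_bool ((p \<in> h) \<noteq> (q \<in> h))) + (\<Sum>h\<in>H. crossings (\<lambda>p. p \<in> h) ps)"
    by (rule add_mono)
  then show ?case unfolding a crossings_simps sum.distrib .
qed

section \<open>Intersections of boundedly many half-planes and the colouring\<close>

definition ranges :: "nat \<Rightarrow> (real^2) set \<Rightarrow> (real^2) set set" where
  "ranges k S = {S \<inter> \<Inter>H | H. H \<subseteq> traces S \<and> finite H \<and> card H \<le> k}"

text \<open>For counting, sets of at most k traces become lists of length exactly k, padded with the
  trace \<open>S\<close>, which does not affect the intersection with \<open>S\<close>.\<close>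

lemma ranges_subset: "ranges k S \<subseteq> (\<lambda>hs. S \<inter> \<Inter>(set hs)) ` {hs. set hs \<subseteq> traces S \<and> length hs = k}"
proof
  fix R assume "R \<in> ranges k S"
  then obtain H where H: "R = S \<inter> \<Inter>H" "H \<subseteq> traces S" "finite H" "card H \<le> k"
    by (auto simp: ranges_def)
  obtain hs where hs: "set hs = H" "distinct hs"
    using finite_distinct_list[OF H(3)] by blast
  let ?hs = "hs @ replicate (k - length hs) S"
  have "length hs \<le> k" using hs H(4) by (metis distinct_card)
  then have "length ?hs = k" "set ?hs \<subseteq> traces S" "R = S \<inter> \<Inter>(set ?hs)"
    using hs H self_in_traces[of S] by (auto simp: set_replicate_conv_if)
  then show "R \<in> (\<lambda>hs. S \<inter> \<Inter>(set hs)) ` {hs. set hs \<subseteq> traces S \<and> length hs = k}"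
    by blast
qed

lemma
  assumes "finite S"
  shows finite_ranges: "finite (ranges k S)"
    and card_ranges_le: "card (ranges k S) \<le> (card S + 1) ^ (3 * k)"
proof -
  let ?L = "{hs. set hs \<subseteq> traces S \<and> length hs = k}"
  have fin: "finite ?L"
    using finite_traces[OF assms] by (rule finite_lists_length_eq)
  then show "finite (ranges k S)"
    by (intro finite_subset[OF ranges_subset] finite_imageI)
  have "card (ranges k S) \<le> card ?L"
    using fin ranges_subset by (rule surj_card_le)
  also have "\<dots> = card (traces S) ^ k"
    using finite_traces[OF assms] by (rule card_lists_length_eq)
  also have "\<dots> \<le> ((card S + 1) ^ 3) ^ k"
    using card_traces_le[OF assms] by (intro power_mono) auto
  finally show "card (ranges k S) \<le> (card S + 1) ^ (3 * k)"
    by (simp add: power_mult)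
qed

lemma low_discrepancy_coloring:
  assumes S: "finite S" "2 \<le> card S"
  obtains X where "coloring S X"
    "\<And>R. R \<in> ranges 8 S \<Longrightarrow> real_of_int (disc X R) \<le> 564 * real (card S) powr (1/4) * sqrt (ln (real (card S)))"
proof -
  define n where "n = real (card S)"
  define q where "q = n powr (1/4)"
  define s where "s = sqrt (ln n)"
  have n: "2 \<le> n" using S by (simp add: n_def)
  have "2/3 \<le> ln (2::real)" by (rule ln2_ge_two_thirds)
  also have "ln 2 \<le> ln n" using n by simp
  finally have ln_n: "2/3 \<le> ln n" .
  have q1: "1 \<le> q" unfolding q_def using n by (intro ge_one_powr_ge_zero) auto
  have qq: "q ^ 2 = sqrt n"
    using n by (simp add: q_def powr_half_sqrt[symmetric] powr_powr flip: powr_realpow)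
  have s2: "s ^ 2 = ln n" using ln_n by (simp add: s_def)
  have s0: "1/2 \<le> s" unfolding s_def using ln_n by (intro real_le_rsqrt) (simp add: power2_eq_square)
  have "ln n = 2 * ln (sqrt n)" using n by (simp add: ln_sqrt)
  also have "\<dots> \<le> 2 * (sqrt n - 1)" using n by (intro mult_left_mono ln_le_minus_one) auto
  finally have ln_le: "ln n \<le> 2 * sqrt n" by simp
  have "n + 1 \<le> n ^ 2"
  proof -
    have "2 * n \<le> n * n" using n by (intro mult_right_mono) auto
    then show ?thesis using n unfolding power2_eq_square by linarith
  qed
  then have "ln (n + 1) \<le> ln (n ^ 2)" using n by (intro ln_mono) auto
  then have ln_n1: "ln (n + 1) \<le> 2 * ln n" using n by (simp add: ln_realpow)

  obtain ps where ps: "distinct (endpoints ps)" "set (endpoints ps) \<subseteq> S" "card (S - set (endpoints ps)) \<le> 1"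
    and cr: "\<And>x. x \<in> traces S \<Longrightarrow> ln 2 * real (crossings (\<lambda>p. p \<in> x) ps) \<le> ln (card (traces S)) + 46 * sqrt n"
    by (rule low_crossing_matching[OF S(1) finite_traces[OF S(1)] dual_vc2_traces]) (rule that; simp add: n_def)
  \<comment> \<open>ln of the number of traces is at most 3 ln (n+1) \<le> 6 ln n \<le> 12 sqrt n;
    then 12 + 46 = 58 is doubled because ln 2 \<ge> 1/2.\<close>
  have cr_half: "real (crossings (\<lambda>p. p \<in> x) ps) \<le> 116 * sqrt n" if "x \<in> traces S" for x
  proof -
    have "0 < card (traces S)"
      using finite_traces[OF S(1)] that by (auto simp: card_gt_0_iff)
    moreover have "real (card (traces S)) \<le> real ((card S + 1) ^ 3)"
      using card_traces_le[OF S(1)] by (rule of_nat_mono)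
    ultimately have "ln (card (traces S)) \<le> ln ((n + 1) ^ 3)"
      unfolding n_def by (intro ln_mono) (simp_all add: add_ac)
    also have "\<dots> \<le> 12 * sqrt n" using n ln_n1 ln_le by (simp add: ln_realpow)
    finally have "ln 2 * real (crossings (\<lambda>p. p \<in> x) ps) \<le> 58 * sqrt n"
      using cr[OF that] by linarith
    moreover have "1/2 * real (crossings (\<lambda>p. p \<in> x) ps) \<le> ln 2 * real (crossings (\<lambda>p. p \<in> x) ps)"
      using ln2_ge_two_thirds by (intro mult_right_mono) auto
    ultimately show ?thesis by linarith
  qed
  have cr_range: "real (crossings (\<lambda>p. p \<in> R) ps) \<le> 928 * sqrt n" if R: "R \<in> ranges 8 S" for R
  proof -
    obtain H where H: "R = S \<inter> \<Inter>H" "H \<subseteq> traces S" "finite H" "card H \<le> 8"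
      using R by (auto simp: ranges_def)
    have "real (crossings (\<lambda>p. p \<in> R) ps) \<le> real (\<Sum>h\<in>H. crossings (\<lambda>p. p \<in> h) ps)"
      unfolding H(1) using crossings_Inter_le[OF H(3) ps(2)] by (rule of_nat_mono)
    also have "\<dots> = (\<Sum>h\<in>H. real (crossings (\<lambda>p. p \<in> h) ps))" by simp
    also have "\<dots> \<le> real (card H) * (116 * sqrt n)"
      using cr_half H(2) by (intro sum_bounded_above) auto
    also have "\<dots> \<le> 8 * (116 * sqrt n)"
      using H(4) n by (intro mult_right_mono) auto
    finally show ?thesis by simp
  qed

  \<comment> \<open>This u balances the two exponents: u^2 times the crossing bound becomes a
    multiple of ln n, as is the logarithm of the number of ranges. The condition u \<le> 1 follows
    from ln n \<le> 2 sqrt n.\<close>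
  define u where "u = s / (2 * q)"
  have u0: "0 < u" using s0 q1 by (simp add: u_def)
  have u2: "u ^ 2 * sqrt n = ln n / 4"
    using q1 by (simp add: u_def power_divide power_mult_distrib s2 flip: qq)
  have sq: "0 < sqrt n" using n by simp
  then have "u ^ 2 * sqrt n \<le> 1 * sqrt n" using u2 ln_le by linarith
  then have "u ^ 2 \<le> 1" using sq by (rule mult_right_le_imp_le)
  then have u1: "u \<le> 1" using u0 by (simp add: power2_le_iff_abs_le abs_square_le_1)
  let ?E = "set (endpoints ps)" and ?RR = "ranges 8 S"
  let ?F = "\<lambda>X R. exp (u * real_of_int (\<Sum>y\<in>R \<inter> ?E. X y)) + exp (- u * real_of_int (\<Sum>y\<in>R \<inter> ?E. X y))"
  have "\<exists>X. X \<in> UNIV \<rightarrow> {-1, 1 :: int} \<and>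
      (\<Sum>R\<in>?RR. 1 * ?F X R) \<le> (\<Sum>R\<in>?RR. 1 * (2 * exp (u ^ 2 * crossings (\<lambda>p. p \<in> R) ps)))"
    using ps(1) u0 u1 by (intro pair_coloring[where v = "\<lambda>_. 1"]) auto
  then obtain X where X: "X \<in> UNIV \<rightarrow> {-1, 1 :: int}"
    and le: "(\<Sum>R\<in>?RR. 1 * ?F X R) \<le> (\<Sum>R\<in>?RR. 1 * (2 * exp (u ^ 2 * crossings (\<lambda>p. p \<in> R) ps)))"
    by blast
  have "(\<Sum>R\<in>?RR. 2 * exp (u ^ 2 * crossings (\<lambda>p. p \<in> R) ps)) \<le> real (card ?RR) * (2 * exp (232 * ln n))"
  proof (rule sum_bounded_above)
    fix R assume "R \<in> ?RR"
    then have "u ^ 2 * real (crossings (\<lambda>p. p \<in> R) ps) \<le> u ^ 2 * (928 * sqrt n)"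
      using cr_range by (intro mult_left_mono) auto
    also have "\<dots> = 232 * ln n" using u2 by (simp add: mult_ac)
    finally show "2 * exp (u ^ 2 * real (crossings (\<lambda>p. p \<in> R) ps)) \<le> 2 * exp (232 * ln n)"
      by simp
  qed
  \<comment> \<open>There are at most (n+1)^24 \<le> n^48 ranges, and the factor 2 is absorbed by n;
    so 281 = 48 + 1 + 232.\<close>
  also have "\<dots> \<le> exp (48 * ln n) * (exp (ln n) * exp (232 * ln n))"
  proof -
    have "real (card ?RR) \<le> real ((card S + 1) ^ (3 * 8))"
      using card_ranges_le[OF S(1), of 8] by (rule of_nat_mono)
    also have "\<dots> = (n + 1) ^ 24" by (simp add: n_def add_ac)
    also have "\<dots> = exp (24 * ln (n + 1))" using exp_of_nat_mult[of 24 "ln (n + 1)"] n by simp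
    also have "\<dots> \<le> exp (48 * ln n)" using ln_n1 by simp
    finally have "real (card ?RR) \<le> exp (48 * ln n)" .
    then show ?thesis using n by (intro mult_mono) auto
  qed
  also have "\<dots> = exp (281 * ln n)" by (simp flip: exp_add)
  finally have total: "(\<Sum>R\<in>?RR. ?F X R) \<le> exp (281 * ln n)" using le by simp
  have "real_of_int (disc X R) \<le> 564 * q * s" if R: "R \<in> ?RR" for R
  proof -
    define Y where "Y = real_of_int (\<Sum>y\<in>R \<inter> ?E. X y)"
    have RS: "R \<subseteq> S" using R by (auto simp: ranges_def)
    have "exp (u * \<bar>Y\<bar>) \<le> ?F X R"
      unfolding Y_def[symmetric] by (auto simp: abs_if)
    also have "\<dots> \<le> (\<Sum>R\<in>?RR. ?F X R)"
      using R finite_ranges[OF S(1)] by (intro member_le_sum) (auto simp: add_nonneg_nonneg)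
    also have "\<dots> \<le> exp (281 * ln n)" by (rule total)
    finally have "u * \<bar>Y\<bar> \<le> 281 * s ^ 2" by (simp add: s2)
    then have "s * \<bar>Y\<bar> \<le> s * (562 * q * s)"
      using q1 by (simp add: u_def field_simps power2_eq_square)
    then have Y: "\<bar>Y\<bar> \<le> 562 * q * s" using s0 by simp
    have "finite R" using RS S(1) by (rule finite_subset)
    then have "(\<Sum>y\<in>R. X y) = (\<Sum>y\<in>R \<inter> ?E. X y) + (\<Sum>y\<in>R - ?E. X y)"
      by (simp add: sum.Int_Diff)
    moreover have "\<bar>\<Sum>y\<in>R - ?E. X y\<bar> \<le> 1"
    proof -
      have "\<bar>\<Sum>y\<in>R - ?E. X y\<bar> \<le> (\<Sum>y\<in>R - ?E. \<bar>X y\<bar>)" by (rule sum_abs)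
      also have "\<dots> = (\<Sum>y\<in>R - ?E. 1)"
      proof (intro sum.cong refl)
        fix y
        have "X y \<in> {-1, 1}" using X by (rule Pi_mem) simp
        then show "\<bar>X y\<bar> = 1" by auto
      qed
      also have "\<dots> = int (card (R - ?E))" by simp
      also have "card (R - ?E) \<le> card (S - ?E)"
        using RS S(1) by (intro card_mono) auto
      finally show ?thesis using ps(3) by linarith
    qed
    ultimately have "real_of_int (disc X R) \<le> \<bar>Y\<bar> + 1"
      unfolding disc_def Y_def by linarith
    \<comment> \<open>Dividing 281 s^2 by u = s / (2 q) has given 562 q s. The unpaired point adds 1
      \<le> 2 q s, whence 564.\<close>
    also have "\<dots> \<le> 562 * q * s + 2 * (q * s)"
    proof -
      have "1 * (1/2) \<le> q * s" using q1 s0 by (intro mult_mono) auto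
      then show ?thesis using Y by linarith
    qed
    finally show ?thesis by (simp add: algebra_simps)
  qed
  moreover have "coloring S X" using X by (auto simp: coloring_def Pi_iff)
  ultimately show ?thesis unfolding q_def s_def n_def by (intro that)
qed

theorem theorem10:
  shows "\<exists>K::real. K > 0 \<and>
    (\<forall>n::nat. n \<ge> 2 \<longrightarrow>
      (\<forall>S::(real^2) set. finite S \<and> card S = n \<and> general_position S \<longrightarrow>
        (\<exists>X. coloring S X \<and>
           real_of_int (coarseness S X) \<le> K * real n powr (1/4) * sqrt (ln (real n)))))"
proof (intro exI[of _ 564] conjI allI impI)
  show "(0::real) < 564" by simp
  fix n :: nat and S :: "(real^2) set"
  assume n: "2 \<le> n" and "finite S \<and> card S = n \<and> general_position S"
  then have S: "finite S" "card S = n" "2 \<le> card S" "S \<noteq> {}" by auto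
  obtain X where X: "coloring S X" and low:
    "\<And>R. R \<in> ranges 8 S \<Longrightarrow> real_of_int (disc X R) \<le> 564 * real n powr (1/4) * sqrt (ln (real n))"
    by (rule low_discrepancy_coloring[OF S(1,3), unfolded S(2)]) (rule that; blast)
  have "coarseness S X \<in> disc_partition X ` {P. convex_partition S P}"
    unfolding coarseness_def using finite_convex_partitions convex_partitions_nonempty S(1,4)
    by (intro Max_in) auto
  then obtain P where P: "convex_partition S P" "coarseness S X = disc_partition X P" by blast
  obtain A H where AH: "A \<in> P" "H \<subseteq> traces S" "finite H" "card H \<le> 8" "A = S \<inter> \<Inter>H"
    using simple_piece[OF S(1,4) P(1)] by blast
  have "A \<in> ranges 8 S" unfolding ranges_def using AH by blast
  have "coarseness S X \<le> disc X A"
    unfolding P(2) disc_partition_def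
    using convex_partition_finite_nonempty(1)[OF S(1,4) P(1)] AH(1) by (intro Min_le) auto
  then have "real_of_int (coarseness S X) \<le> 564 * real n powr (1/4) * sqrt (ln (real n))"
    using low[OF \<open>A \<in> ranges 8 S\<close>] by linarith
  with X show "\<exists>X. coloring S X \<and>
      real_of_int (coarseness S X) \<le> 564 * real n powr (1/4) * sqrt (ln (real n))" by blast
qed

end
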